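(* Let $\Omega\subset\mathbb{R}^2$ be a bounded domain with Lipschitz boundary, let $\beta_1\ge0$, and for $\beta_2,\beta_3,\beta_4\ge0$ set ${\bm\beta}=(\sqrt{\beta_1},\sqrt{\beta_2},\sqrt{\beta_3},\sqrt{\beta_4})$. The nullspace $\mathcal{N}(R_{\bm\beta})=\{u\in L^2(\Omega):R_{\bm\beta}(u)=0\}$ is characterised as follows (independently of whether $\beta_1=0$ or $\beta_1>0$): (1) If $\beta_2,\beta_3,\beta_4>0$, then $\mathcal{N}(R_{\bm\beta})$ consists exactly of the affine functions, i.e. the linear combinations of $x_1,\ x_2,\ 1$. (2) If $\beta_2=0$ and $\beta_3,\beta_4>0$, then $\mathcal{N}(R_{\bm\beta})$ consists exactly of the linear combinations of $x_1^2+x_2^2,\ x_1,\ x_2,\ 1$. (3) If $\beta_3=0$ and $\beta_2,\beta_4>0$, then $\mathcal{N}(R_{\bm\beta})$ consists exactly of the linear combinations of $x_1^2-x_2^2,\ x_1,\ x_2,\ 1$. (4) If $\beta_4=0$ and $\beta_2,\beta_3>0$, then $\mathcal{N}(R_{\bm\beta})$ consists exactly of the linear combinations of $x_1x_2,\ x_1,\ x_2,\ 1$.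
   Context: $\mathcal{M}(\Omega,\mathbb{R}^d)$ is the space of finite $\mathbb{R}^d$-valued Radon measures on $\Omega$ with the dual norm $\|\mu\|_{\mathcal{M}(\Omega,\mathbb{R}^d)}=\sup\{\sum_{i=1}^d\int_\Omega\varphi_i\,d\mu_i:\varphi\in C_0(\Omega,\mathbb{R}^d),\ \|\varphi\|_\infty\le1\}$, where $\|\varphi\|_\infty$ is the supremum of the pointwise Euclidean norm. The norm is set to $+\infty$ for distributions that are not finite Radon measures. $\nabla u$ is the distributional gradient. "Domain" means open and connected. For $w=(w_1,w_2)\in\mathcal{M}(\Omega,\mathbb{R}^2)$, with derivatives in the sense of distributions, $\mathrm{curl}(w)=\partial_{x_1}w_2-\partial_{x_2}w_1$, $\mathrm{div}(w)=\partial_{x_1}w_1+\partial_{x_2}w_2$, $\mathrm{sh}_1(w)=\partial_{x_2}w_2-\partial_{x_1}w_1$, $\mathrm{sh}_2(w)=\partial_{x_2}w_1+\partial_{x_1}w_2$, and $\nabla_Nw=(\mathrm{curl}(w),\mathrm{div}(w),\mathrm{sh}_1(w),\mathrm{sh}_2(w))^\top$. Then $$R_{\bm\beta}(u)=\inf_{w\in\mathcal{M}(\Omega,\mathbb{R}^2)}\|\nabla u-w\|_{\mathcal{M}(\Omega,\mathbb{R}^2)}+\|\mathrm{diag}({\bm\beta})\nabla_Nw\|_{\mathcal{M}(\Omega,\mathbb{R}^4)}.$$ *)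

theory Defs
  imports "HOL-Analysis.Analysis"
begin

section \<open>Domains\<close>

text \<open>Near every boundary point the set is, in suitable orthonormal coordinates
  \<open>(x \<bullet> t, x \<bullet> n)\<close>, the region above the graph of a Lipschitz function. The coordinates are
  not centred at the boundary point; the shift is absorbed into \<open>g\<close>.\<close>

definition lipschitz_boundary :: "(real^2) set \<Rightarrow> bool" where
  "lipschitz_boundary \<Omega> \<longleftrightarrow>
    (\<forall>p \<in> frontier \<Omega>. \<exists>r>0. \<exists>t n :: real^2. \<exists>(g :: real \<Rightarrow> real) L.
       norm t = 1 \<and> norm n = 1 \<and> t \<bullet> n = 0 \<and> L-lipschitz_on UNIV g \<and>
       \<Omega> \<inter> ball p r = {x \<in> ball p r. g (x \<bullet> t) < x \<bullet> n})"

definition bounded_lipschitz_domain :: "(real^2) set \<Rightarrow> bool" where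
  "bounded_lipschitz_domain \<Omega> \<longleftrightarrow> open \<Omega> \<and> connected \<Omega> \<and> bounded \<Omega> \<and> lipschitz_boundary \<Omega>"


section \<open>Test functions and distributions\<close>

definition pderiv_at :: "2 \<Rightarrow> (real^2 \<Rightarrow> real) \<Rightarrow> real^2 \<Rightarrow> real" where
  "pderiv_at i \<phi> = (\<lambda>x. frechet_derivative \<phi> (at x) (axis i 1))"

definition smooth :: "(real^2 \<Rightarrow> real) \<Rightarrow> bool" where
  "smooth \<phi> \<longleftrightarrow> (\<forall>is x. foldr pderiv_at is \<phi> differentiable (at x))"

text \<open>Elements of $C_c^\infty(\Omega)$, extended by zero to the whole plane.\<close>

definition test_function :: "(real^2) set \<Rightarrow> (real^2 \<Rightarrow> real) \<Rightarrow> bool" where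
  "test_function \<Omega> \<phi> \<longleftrightarrow>
    smooth \<phi> \<and> compact (closure {x. \<phi> x \<noteq> 0}) \<and> closure {x. \<phi> x \<noteq> 0} \<subseteq> \<Omega>"

text \<open>Distributions on \<open>\<Omega>\<close> are functionals on test functions; only their values on
  test functions of \<open>\<Omega>\<close> matter. Vector-valued distributions take values in \<open>real ^ 'd\<close>.
  Continuity is not part of the type: the functionals below all arise from $L^2$ functions and
  finite measures by differentiation and linear combination.\<close>

type_synonym distribution = "(real^2 \<Rightarrow> real) \<Rightarrow> real"
type_synonym 'd vdistribution = "(real^2 \<Rightarrow> real) \<Rightarrow> real^'d"

definition distr_pderiv :: "2 \<Rightarrow> distribution \<Rightarrow> distribution" where
  "distr_pderiv i T = (\<lambda>\<phi>. - T (pderiv_at i \<phi>))"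

definition dcomp :: "('d::finite) vdistribution \<Rightarrow> 'd \<Rightarrow> distribution" where
  "dcomp W i = (\<lambda>\<phi>. W \<phi> $ i)"

definition fun_distr :: "(real^2) set \<Rightarrow> (real^2 \<Rightarrow> real) \<Rightarrow> distribution" where
  "fun_distr \<Omega> u = (\<lambda>\<phi>. \<integral>x. u x * \<phi> x \<partial>(lebesgue_on \<Omega>))"

definition grad :: "distribution \<Rightarrow> 2 vdistribution" where
  "grad T = (\<lambda>\<phi>. \<chi> i. distr_pderiv i T \<phi>)"

definition curl :: "2 vdistribution \<Rightarrow> distribution" where
  "curl W = (\<lambda>\<phi>. distr_pderiv 1 (dcomp W 2) \<phi> - distr_pderiv 2 (dcomp W 1) \<phi>)"

definition divg :: "2 vdistribution \<Rightarrow> distribution" where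
  "divg W = (\<lambda>\<phi>. distr_pderiv 1 (dcomp W 1) \<phi> + distr_pderiv 2 (dcomp W 2) \<phi>)"

definition sh1 :: "2 vdistribution \<Rightarrow> distribution" where
  "sh1 W = (\<lambda>\<phi>. distr_pderiv 2 (dcomp W 2) \<phi> - distr_pderiv 1 (dcomp W 1) \<phi>)"

definition sh2 :: "2 vdistribution \<Rightarrow> distribution" where
  "sh2 W = (\<lambda>\<phi>. distr_pderiv 2 (dcomp W 1) \<phi> + distr_pderiv 1 (dcomp W 2) \<phi>)"

definition nabla_N :: "2 vdistribution \<Rightarrow> 4 vdistribution" where
  "nabla_N W = (\<lambda>\<phi>. vector [curl W \<phi>, divg W \<phi>, sh1 W \<phi>, sh2 W \<phi>])"

definition diag_mult :: "real^('d::finite) \<Rightarrow> 'd vdistribution \<Rightarrow> 'd vdistribution" where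
  "diag_mult b W = (\<lambda>\<phi>. \<chi> i. b $ i * W \<phi> $ i)"


section \<open>Finite vector-valued Radon measures\<close>

text \<open>Countably additive set functions on the Borel sets of \<open>\<Omega>\<close>. Being real-vector-valued they
  are finite, and on an open subset of the plane every finite Borel measure is Radon, so no
  regularity condition is needed. Their values on other sets are irrelevant.\<close>

definition radon_measures :: "(real^2) set \<Rightarrow> ((real^2) set \<Rightarrow> real^'d::finite) set" where
  "radon_measures \<Omega> = {\<mu>. \<forall>A :: nat \<Rightarrow> (real^2) set.
     range A \<subseteq> sets (restrict_space borel \<Omega>) \<longrightarrow> disjoint_family A \<longrightarrow>
     (\<lambda>k. \<mu> (A k)) sums \<mu> (\<Union>k. A k)}"

text \<open>Positive part $\nu^+$ of the Jordan decomposition of a finite signed measure,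
  $\nu^+(A) = \sup\{\nu(B) : B \subseteq A\}$; the negative part is $(-\nu)^+$. Since \<open>ennreal\<close> sends
  negative reals to 0, the supremum is unaffected by it (\<open>B = {}\<close> contributes 0).\<close>

definition pos_variation :: "(real^2) set \<Rightarrow> ((real^2) set \<Rightarrow> real) \<Rightarrow> (real^2) measure" where
  "pos_variation \<Omega> \<nu> = measure_of \<Omega> (sets (restrict_space borel \<Omega>))
     (\<lambda>A. SUP B \<in> {B \<in> sets (restrict_space borel \<Omega>). B \<subseteq> A}. ennreal (\<nu> B))"

definition signed_integral ::
    "(real^2) set \<Rightarrow> ((real^2) set \<Rightarrow> real) \<Rightarrow> (real^2 \<Rightarrow> real) \<Rightarrow> real" where
  "signed_integral \<Omega> \<nu> f =
     (\<integral>x. f x \<partial>(pos_variation \<Omega> \<nu>)) - (\<integral>x. f x \<partial>(pos_variation \<Omega> (\<lambda>A. - \<nu> A)))"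

definition measure_distr :: "(real^2) set \<Rightarrow> ((real^2) set \<Rightarrow> real^('d::finite)) \<Rightarrow> 'd vdistribution" where
  "measure_distr \<Omega> \<mu> = (\<lambda>\<phi>. \<chi> i. signed_integral \<Omega> (\<lambda>A. \<mu> A $ i) \<phi>)"

text \<open>$C_0(\Omega,\mathbb{R}^d)$: continuous functions on \<open>\<Omega>\<close> vanishing at infinity.\<close>

definition C0 :: "(real^2) set \<Rightarrow> (real^2 \<Rightarrow> real^('d::finite)) set" where
  "C0 \<Omega> = {\<phi>. continuous_on \<Omega> \<phi> \<and> (\<forall>e>0. compact {x \<in> \<Omega>. e \<le> norm (\<phi> x)})}"

definition measure_norm :: "(real^2) set \<Rightarrow> ((real^2) set \<Rightarrow> real^('d::finite)) \<Rightarrow> ereal" where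
  "measure_norm \<Omega> \<mu> =
     (SUP \<phi> \<in> {\<phi> \<in> C0 \<Omega>. \<forall>x \<in> \<Omega>. norm (\<phi> x) \<le> 1}.
        ereal (\<Sum>i\<in>UNIV. signed_integral \<Omega> (\<lambda>A. \<mu> A $ i) (\<lambda>x. \<phi> x $ i)))"

text \<open>The norm of a distribution: a finite Radon measure representing it is unique as a measure if
  it exists, so the infimum is the norm of that measure, and it is \<open>\<infinity>\<close> (the infimum of the
  empty set) for distributions that are not finite Radon measures.\<close>

definition distr_norm :: "(real^2) set \<Rightarrow> ('d::finite) vdistribution \<Rightarrow> ereal" where
  "distr_norm \<Omega> T =
     (INF \<mu> \<in> {\<mu> \<in> radon_measures \<Omega>. \<forall>\<phi>. test_function \<Omega> \<phi> \<longrightarrow> T \<phi> = measure_distr \<Omega> \<mu> \<phi>}.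
        measure_norm \<Omega> \<mu>)"


section \<open>The regulariser and its nullspace\<close>

definition R_reg :: "(real^2) set \<Rightarrow> real^4 \<Rightarrow> (real^2 \<Rightarrow> real) \<Rightarrow> ereal" where
  "R_reg \<Omega> b u = (INF w \<in> radon_measures \<Omega>.
     distr_norm \<Omega> (\<lambda>\<phi>. grad (fun_distr \<Omega> u) \<phi> - measure_distr \<Omega> w \<phi>) +
     distr_norm \<Omega> (diag_mult b (nabla_N (measure_distr \<Omega> w))))"

definition L2 :: "(real^2) set \<Rightarrow> (real^2 \<Rightarrow> real) set" where
  "L2 \<Omega> = {u \<in> borel_measurable (lebesgue_on \<Omega>). integrable (lebesgue_on \<Omega>) (\<lambda>x. (u x)\<^sup>2)}"

text \<open>A set of functions rather than of almost-everywhere classes; it is closed under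
  almost-everywhere equality on \<open>\<Omega>\<close>.\<close>

definition nullspace :: "(real^2) set \<Rightarrow> real^4 \<Rightarrow> (real^2 \<Rightarrow> real) set" where
  "nullspace \<Omega> b = {u \<in> L2 \<Omega>. R_reg \<Omega> b u = 0}"

end

theory Submission
  imports Defs
begin

text \<open>Both inclusions go through one description of the nullspace
  (\<open>nullspace_eq\<close>): if at least two of the weights \<open>\<beta> $ 2\<close>, \<open>\<beta> $ 3\<close>, \<open>\<beta> $ 4\<close> are
  nonzero, it consists of the functions that agree almost everywhere with a polynomial
  \<open>A/2 * x1^2 + B * x1 * x2 + C/2 * x2^2 + a * x1 + b * x2 + c\<close> for which
  \<open>\<beta> $ 2 * (A + C)\<close>, \<open>\<beta> $ 3 * (C - A)\<close> and \<open>\<beta> $ 4 * B\<close> vanish. The four cases of the theorem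
  are read off from these three equations.

  A function with \<open>R_reg = 0\<close> need not come with a minimising measure, but it does not have to.
  Along a minimising sequence \<open>w\<close> the distributions \<open>w\<close> converge to the gradient of \<open>u\<close>, because
  the pairing of a measure with a test function is controlled by the measure norm, and the
  weighted \<open>nabla_N w\<close> converges to 0; differentiation of distributions is continuous, so the
  weighted \<open>nabla_N\<close> of the gradient of \<open>u\<close> is 0
  (\<open>R_reg_eq_0_imp_weighted_second_derivatives\<close>). The curl of a gradient is 0, which leaves three
  equations; any two of them force all third derivatives of \<open>u\<close> to vanish.

  That a distribution with vanishing third derivatives is a quadratic polynomial is shown on
  boxes, and only with test functions of the form \<open>f (x1) * g (x2)\<close>. A bilinear
  functional of \<open>(f, g)\<close> that vanishes on derivatives in either argument is a multiple of the
  product of the integrals, since a bump with integral 0 is the derivative of a bump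
  (\<open>bilinear_killed_by_deriv\<close>). Applied to the second derivatives of \<open>u\<close>, then to its
  first derivatives and to \<open>u\<close> itself after subtraction of what is already known, this yields the
  polynomial (\<open>weakly_quadratic_on_box\<close>). Products of bumps approximate indicators of boxes,
  and Lebesgue differentiation turns the weak identity into one almost everywhere
  (\<open>fundamental_lemma_box\<close>). The coefficients are locally constant on a connected set, so the
  local polynomials coincide (\<open>locally_quadratic_imp_quadratic\<close>).

  Conversely, for such a polynomial the measure whose density is its gradient makes both terms of
  \<open>R_reg\<close> vanish (\<open>quadratic_in_nullspace\<close>); this needs the positive variation of a measure
  with a density, and integration by parts.\<close>

section \<open>Smooth bumps on the line\<close>

fun times_differentiable :: "nat \<Rightarrow> (real \<Rightarrow> real) \<Rightarrow> bool" where
  "times_differentiable 0 f \<longleftrightarrow> True"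
| "times_differentiable (Suc n) f \<longleftrightarrow>
     (\<forall>x. f differentiable (at x)) \<and> times_differentiable n (deriv f)"

lemma deriv_eqI: "(\<And>x. (f has_field_derivative f' x) (at x)) \<Longrightarrow> deriv f = f'"
  by (rule ext) (rule DERIV_imp_deriv)

lemma times_differentiableI:
  assumes "\<And>x. (f has_field_derivative f' x) (at x)" "times_differentiable n f'"
  shows "times_differentiable (Suc n) f"
  using assms deriv_eqI[of f f'] by (auto simp: real_differentiable_def)

lemma times_differentiableE:
  assumes "times_differentiable (Suc n) f"
  shows "(f has_field_derivative deriv f x) (at x)"
  using assms by (auto simp: DERIV_deriv_iff_real_differentiable)

lemma times_differentiable_Suc: "times_differentiable (Suc n) f \<Longrightarrow> times_differentiable n f"
  by (induction n arbitrary: f) auto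

lemma times_differentiable_const: "times_differentiable n (\<lambda>x. c)"
  by (induction n arbitrary: c) auto

lemma times_differentiable_add:
  "times_differentiable n f \<Longrightarrow> times_differentiable n g \<Longrightarrow> times_differentiable n (\<lambda>x. f x + g x)"
proof (induction n arbitrary: f g)
  case (Suc n)
  show ?case
    by (rule times_differentiableI[where f' = "\<lambda>x. deriv f x + deriv g x"])
       (use Suc in \<open>auto intro!: DERIV_add simp: DERIV_deriv_iff_real_differentiable\<close>)
qed simp

text \<open>The induction works on the product as a whole: the derivative is again a sum of products of
  functions that are differentiable one time less, so no Leibniz formula for higher derivatives
  is needed.\<close>

lemma times_differentiable_mult:
  "times_differentiable n f \<Longrightarrow> times_differentiable n g \<Longrightarrow> times_differentiable n (\<lambda>x. f x * g x)"
proof (induction n arbitrary: f g)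
  case (Suc n)
  note fg = Suc.prems[THEN times_differentiable_Suc]
  show ?case
  proof (rule times_differentiableI[where f' = "\<lambda>x. deriv f x * g x + deriv g x * f x"])
    show "times_differentiable n (\<lambda>x. deriv f x * g x + deriv g x * f x)"
      using Suc fg by (intro times_differentiable_add Suc.IH) auto
  qed (intro DERIV_mult times_differentiableE[OF Suc.prems(1)] times_differentiableE[OF Suc.prems(2)])
qed simp

lemma times_differentiable_affine:
  "times_differentiable n f \<Longrightarrow> times_differentiable n (\<lambda>x. f (c * x + d))"
proof (induction n arbitrary: f)
  case (Suc n)
  show ?case
  proof (rule times_differentiableI[where f' = "\<lambda>x. deriv f (c * x + d) * c"])
    show "times_differentiable n (\<lambda>x. deriv f (c * x + d) * c)"
      using Suc by (intro times_differentiable_mult times_differentiable_const Suc.IH) auto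
    show "((\<lambda>x. f (c * x + d)) has_real_derivative deriv f (c * x + d) * c) (at x)" for x
      by (rule DERIV_chain2[OF times_differentiableE[OF Suc.prems]])
         (auto intro!: derivative_eq_intros)
  qed
qed simp

lemma tendsto_poly_exp_inverse:
  "((\<lambda>x::real. poly p (1/x) * exp (-1/x)) \<longlongrightarrow> 0) (at_right 0)"
proof -
  have "((\<lambda>y. poly p y * exp (-y)) \<longlongrightarrow> 0) at_top"
  proof -
    have "((\<lambda>y::real. \<Sum>i\<le>degree p. coeff p i * (y ^ i / exp y)) \<longlongrightarrow> (\<Sum>i\<le>degree p. coeff p i * 0)) at_top"
      by (intro tendsto_sum tendsto_mult tendsto_const tendsto_power_div_exp_0)
    then show ?thesis
      by (simp add: poly_altdef sum_distrib_right exp_minus divide_inverse mult.assoc)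
  qed
  from filterlim_compose[OF this filterlim_inverse_at_top_right] show ?thesis
    by (simp add: inverse_eq_divide)
qed

text \<open>The derivatives of \<open>exp (-1/x)\<close>, extended by 0 to the left, are polynomials in \<open>1/x\<close> times
  the same exponential. Taking the whole family makes it closed under differentiation, so
  smoothness is an induction over the number of derivatives.\<close>

definition flat_exp :: "real poly \<Rightarrow> real \<Rightarrow> real" where
  "flat_exp p x = (if x > 0 then poly p (1/x) * exp (-1/x) else 0)"

lemma flat_exp_derivative:
  "(flat_exp p has_field_derivative flat_exp ([:0,0,1:] * (p - pderiv p)) x) (at x)"
proof -
  consider "x > 0" | "x < 0" | "x = 0" by linarith
  then show ?thesis
  proof cases
    case 1
    have "((\<lambda>x. poly p (1/x) * exp (-1/x)) has_field_derivative
        flat_exp ([:0,0,1:] * (p - pderiv p)) x) (at x)"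
      using 1 unfolding flat_exp_def
      by (auto intro!: derivative_eq_intros simp: field_simps power2_eq_square)
    then show ?thesis
      by (rule has_field_derivative_transform_within_open[where S = "{0<..}"])
         (use 1 in \<open>auto simp: flat_exp_def\<close>)
  next
    case 2
    have "((\<lambda>x. 0) has_field_derivative flat_exp ([:0,0,1:] * (p - pderiv p)) x) (at x)"
      using 2 by (auto simp: flat_exp_def)
    then show ?thesis
      by (rule has_field_derivative_transform_within_open[where S = "{..<0}"])
         (use 2 in \<open>auto simp: flat_exp_def\<close>)
  next
    case 3
    \<comment> \<open>the difference quotient at 0 is again a member of the family, for the polynomial \<open>[:0,1:] * p\<close>\<close>
    have r: "((\<lambda>h. flat_exp p h / h) \<longlongrightarrow> 0) (at_right 0)"
      using tendsto_poly_exp_inverse[of "[:0,1:] * p"]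
      by (rule Lim_transform_eventually)
         (auto simp: eventually_at_filter flat_exp_def intro!: eventuallyI)
    have l: "((\<lambda>h. flat_exp p h / h) \<longlongrightarrow> 0) (at_left 0)"
      by (rule tendsto_eventually) (auto simp: eventually_at_filter flat_exp_def intro!: eventuallyI)
    show ?thesis
      unfolding 3 DERIV_def using filterlim_split_at[OF l r] by (simp add: flat_exp_def)
  qed
qed

lemma times_differentiable_flat_exp: "times_differentiable n (flat_exp p)"
  by (induction n arbitrary: p) (simp, metis times_differentiableI flat_exp_derivative)

definition bumps :: "real \<Rightarrow> real \<Rightarrow> (real \<Rightarrow> real) set" where
  "bumps a b = {f. (\<forall>n. times_differentiable n f) \<and> (\<forall>x. x \<notin> {a..b} \<longrightarrow> f x = 0)}"

lemma bumps_outside: "f \<in> bumps a b \<Longrightarrow> x \<notin> {a..b} \<Longrightarrow> f x = 0"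
  by (auto simp: bumps_def)

lemma bumps_deriv: "f \<in> bumps a b \<Longrightarrow> (f has_field_derivative deriv f x) (at x)"
  unfolding bumps_def using times_differentiableE by blast

lemma bumps_continuous: "f \<in> bumps a b \<Longrightarrow> continuous_on S f"
  using bumps_deriv DERIV_continuous_on by (metis has_field_derivative_at_within)

lemma deriv_in_bumps:
  assumes "f \<in> bumps a b"
  shows "deriv f \<in> bumps a b"
proof -
  have "deriv f x = 0" if "x \<notin> {a..b}" for x
  proof (rule DERIV_imp_deriv)
    have "((\<lambda>x. 0) has_field_derivative 0) (at x)" by auto
    then show "(f has_field_derivative 0) (at x)"
      by (rule has_field_derivative_transform_within_open[where S = "- {a..b}"])
         (use that bumps_outside[OF assms] in auto)
  qed
  moreover have "times_differentiable n (deriv f)" for n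
    using assms by (auto simp: bumps_def dest: spec[of _ "Suc n"])
  ultimately show ?thesis by (auto simp: bumps_def)
qed

lemma bumps_diff_cmult: "f \<in> bumps a b \<Longrightarrow> g \<in> bumps a b \<Longrightarrow> (\<lambda>x. f x - c * g x) \<in> bumps a b"
  unfolding bumps_def
  using times_differentiable_add[OF _ times_differentiable_mult[OF times_differentiable_const[of _ "-c"]]]
  by fastforce

lemma bumps_mono: "a' \<le> a \<Longrightarrow> b \<le> b' \<Longrightarrow> bumps a b \<subseteq> bumps a' b'"
  unfolding bumps_def by fastforce



text \<open>This is where compact support meets the fundamental theorem of calculus: the primitive that
  vanishes to the left of the interval vanishes to the right of it as well, because its value
  there is the integral.\<close>

lemma bumps_primitive:
  assumes f: "f \<in> bumps a b" and "a \<le> b" and 0: "integral {a..b} f = 0"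
  shows "\<exists>F\<in>bumps a b. deriv F = f"
proof -
  define F where "F x = integral {a..x} f" for x
  have int: "f integrable_on {c..d}" for c d
    by (intro integrable_continuous_real bumps_continuous[OF f])
  \<comment> \<open>starting the integral to the left of \<open>a\<close> makes \<open>a\<close> an interior point for the fundamental theorem\<close>
  have F_eq: "F x = integral {a - 1..x} f" if "x > a - 1" for x
  proof (cases "x \<ge> a")
    case True
    have "integral {a - 1..x} f = integral {a - 1..a} f + integral {a..x} f"
      using True by (intro Henstock_Kurzweil_Integration.integral_combine[symmetric] int) auto
    moreover have "integral {a - 1..a} f = 0"
      by (rule integral_unique, rule has_integral_spike_finite[where S = "{a}" and f = "\<lambda>_. 0"])
         (auto simp: bumps_outside[OF f])
    ultimately show ?thesis by (simp add: F_def)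
  next
    case False
    have "integral {a - 1..x} f = 0"
      by (rule integral_unique, rule has_integral_spike_finite[where S = "{}" and f = "\<lambda>_. 0"])
         (use False bumps_outside[OF f] in auto)
    then show ?thesis using False by (simp add: F_def)
  qed
  have deriv: "(F has_field_derivative f x) (at x)" for x
  proof (cases "x > a - 1")
    case True
    have "((\<lambda>u. integral {a - 1..u} f) has_real_derivative f x) (at x within {a - 1..x + 1})"
      using True by (intro integral_has_real_derivative bumps_continuous[OF f]) auto
    moreover have "at x within {a - 1..x + 1} = at x"
      using True by (intro at_within_interior) (auto simp: interior_atLeastAtMost_real)
    ultimately have "((\<lambda>u. integral {a - 1..u} f) has_real_derivative f x) (at x)"
      by simp
    then show ?thesis
      by (rule has_field_derivative_transform_within_open[where S = "{a - 1<..}"])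
         (use True F_eq in auto)
  next
    case False
    have "((\<lambda>x. 0) has_field_derivative f x) (at x)"
      using False bumps_outside[OF f, of x] by auto
    then show ?thesis
      by (rule has_field_derivative_transform_within_open[where S = "{..<a}"])
         (use False in \<open>auto simp: F_def\<close>)
  qed
  have "F x = 0" if "x \<notin> {a..b}" for x
  proof (cases "x < a")
    case False
    with that have "b < x" by auto
    have "F x = integral {a..b} f + integral {b..x} f"
      using \<open>a \<le> b\<close> \<open>b < x\<close> unfolding F_def
      by (intro Henstock_Kurzweil_Integration.integral_combine[symmetric] int) auto
    moreover have "integral {b..x} f = 0"
      by (rule integral_unique, rule has_integral_spike_finite[where S = "{b}" and f = "\<lambda>_. 0"])
         (auto simp: bumps_outside[OF f])
    ultimately show ?thesis using 0 by simp
  qed (auto simp: F_def)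
  moreover have "times_differentiable n F" for n
    by (rule times_differentiable_Suc[OF times_differentiableI], rule deriv)
       (use f in \<open>simp add: bumps_def\<close>)
  ultimately show ?thesis using deriv_eqI[of F f, OF deriv] by (auto simp: bumps_def)
qed

text \<open>Rescaling \<open>exp (-1/t)\<close> by large factors pushes it up to 1 at every \<open>t > 0\<close> while it stays 0
  for \<open>t \<le> 0\<close>; so the bumps tend to the indicator of the interval pointwise and stay below 1,
  which is what dominated convergence wants.\<close>

lemma bumps_approx_interval:
  assumes "a < b"
  defines "f \<equiv> \<lambda>n t. flat_exp 1 (real (Suc n) * (t - a)) * flat_exp 1 (real (Suc n) * (b - t))"
  shows "f n \<in> bumps a b" "f n t \<ge> 0" "f n t \<le> 1" "t \<in> {a<..<b} \<Longrightarrow> f n t > 0"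
    "(\<lambda>n. f n t) \<longlonglongrightarrow> indicator {a<..<b} t"
proof -
  have "times_differentiable k (f n)" for k
  proof -
    have "times_differentiable k (\<lambda>t. flat_exp 1 (real (Suc n) * t + - (real (Suc n) * a)) *
        flat_exp 1 ((- real (Suc n)) * t + real (Suc n) * b))"
      by (rule times_differentiable_mult;
          rule times_differentiable_affine; rule times_differentiable_flat_exp)
    then show ?thesis by (simp add: f_def algebra_simps del: of_nat_Suc)
  qed
  moreover have "f n x = 0" if "x \<notin> {a..b}" for x
  proof -
    have "real (Suc n) * (x - a) \<le> 0 \<or> real (Suc n) * (b - x) \<le> 0"
      using that by (auto simp: mult_le_0_iff)
    then show ?thesis by (auto simp: f_def flat_exp_def)
  qed
  ultimately show "f n \<in> bumps a b" by (simp add: bumps_def)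
  show "f n t \<ge> 0" by (simp add: f_def flat_exp_def)
  show "f n t \<le> 1" by (auto simp add: f_def flat_exp_def intro!: mult_le_one)
  show "t \<in> {a<..<b} \<Longrightarrow> f n t > 0" by (simp add: f_def flat_exp_def)
  have lim: "(\<lambda>n. flat_exp 1 (real (Suc n) * s)) \<longlonglongrightarrow> (if s > 0 then 1 else 0)" for s
  proof (cases "s > 0")
    case True
    have "(\<lambda>n. exp (- (1 / s) * inverse (real (Suc n)))) \<longlonglongrightarrow> exp (- (1 / s) * 0)"
      by (intro tendsto_intros LIMSEQ_inverse_real_of_nat)
    moreover have "flat_exp 1 (real (Suc n) * s) = exp (- (1 / s) * inverse (real (Suc n)))" for n
      using True by (simp add: flat_exp_def divide_inverse mult.commute del: of_nat_Suc)
    ultimately show ?thesis using True by simp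
  next
    case False
    then have "\<not> 0 < real (Suc n) * s" for n
      by (metis of_nat_0_less_iff zero_less_Suc zero_less_mult_pos)
    with False show ?thesis by (simp add: flat_exp_def del: of_nat_Suc)
  qed
  show "(\<lambda>n. f n t) \<longlonglongrightarrow> indicator {a<..<b} t"
    using tendsto_mult[OF lim[of "t - a"] lim[of "b - t"]]
    by (auto simp: f_def indicator_def split: if_splits)
qed

section \<open>Test functions in the plane\<close>

definition tensor :: "(real \<Rightarrow> real) \<Rightarrow> (real \<Rightarrow> real) \<Rightarrow> real^2 \<Rightarrow> real" where
  "tensor f g x = f (x $ 1) * g (x $ 2)"

lemma tensor_has_derivative:
  assumes "\<And>t. (f has_field_derivative f' t) (at t)" "\<And>t. (g has_field_derivative g' t) (at t)"
  shows "(tensor f g has_derivative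
    (\<lambda>h. f (x $ 1) * (g' (x $ 2) * h $ 2) + f' (x $ 1) * h $ 1 * g (x $ 2))) (at x)"
proof -
  have 1: "((\<lambda>x. f (x $ 1)) has_derivative (\<lambda>h. f' (x $ 1) * h $ 1)) (at x)"
    using assms(1)[of "x $ 1"] by (intro has_derivative_compose[where g = f and f = "\<lambda>x. x $ 1"])
      (auto simp: has_field_derivative_def intro!: bounded_linear_imp_has_derivative bounded_linear_vec_nth)
  have 2: "((\<lambda>x. g (x $ 2)) has_derivative (\<lambda>h. g' (x $ 2) * h $ 2)) (at x)"
    using assms(2)[of "x $ 2"] by (intro has_derivative_compose[where g = g and f = "\<lambda>x. x $ 2"])
      (auto simp: has_field_derivative_def intro!: bounded_linear_imp_has_derivative bounded_linear_vec_nth)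
  show ?thesis
    using has_derivative_mult[OF 1 2] by (simp add: tensor_def[abs_def])
qed

lemma pderiv_at_eqI: "(\<phi> has_derivative D) (at x) \<Longrightarrow> pderiv_at i \<phi> x = D (axis i 1)"
  unfolding pderiv_at_def by (metis frechet_derivative_at)

context
  fixes a b c d f g
  assumes f: "f \<in> bumps a b" and g: "g \<in> bumps c d"
begin

lemma tensor_bumps_has_derivative:
  "(tensor f g has_derivative
    (\<lambda>h. f (x $ 1) * (deriv g (x $ 2) * h $ 2) + deriv f (x $ 1) * h $ 1 * g (x $ 2))) (at x)"
  by (intro tensor_has_derivative bumps_deriv[OF f] bumps_deriv[OF g])

lemma pderiv_at_tensor: "pderiv_at 1 (tensor f g) = tensor (deriv f) g"
    "pderiv_at 2 (tensor f g) = tensor f (deriv g)"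
  by (auto simp: pderiv_at_eqI[OF tensor_bumps_has_derivative] tensor_def axis_def)

lemma tensor_outside: "x \<notin> cbox (vector [a, c]) (vector [b, d]) \<Longrightarrow> tensor f g x = 0"
  using bumps_outside[OF f] bumps_outside[OF g]
  by (auto simp: tensor_def mem_box_cart forall_2)

end

lemma foldr_pderiv_at_tensor:
  assumes "f \<in> bumps a b" "g \<in> bumps c d"
  shows "\<exists>f'\<in>bumps a b. \<exists>g'\<in>bumps c d. foldr pderiv_at is (tensor f g) = tensor f' g'"
proof (induction "is")
  case (Cons i "is")
  then obtain f' g' where *: "f' \<in> bumps a b" "g' \<in> bumps c d"
    "foldr pderiv_at is (tensor f g) = tensor f' g'" by auto
  moreover have "i = 1 \<or> i = 2" by (rule exhaust_2)
  ultimately show ?case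
    using pderiv_at_tensor[OF *(1,2)] deriv_in_bumps by (simp, blast)
qed (use assms in auto)

lemma test_function_tensor:
  assumes f: "f \<in> bumps a b" and g: "g \<in> bumps c d"
    and sub: "cbox (vector [a, c]) (vector [b, d]) \<subseteq> \<Omega>"
  shows "test_function \<Omega> (tensor f g)"
proof -
  have cl: "closure {x. tensor f g x \<noteq> 0} \<subseteq> cbox (vector [a, c]) (vector [b, d])"
    using tensor_outside[OF f g] by (intro closure_minimal[OF subsetI closed_cbox]) fast
  moreover have "smooth (tensor f g)"
    unfolding smooth_def
  proof (intro allI)
    fix "is" x
    obtain f' g' where "f' \<in> bumps a b" "g' \<in> bumps c d"
      and eq: "foldr pderiv_at is (tensor f g) = tensor f' g'"
      using foldr_pderiv_at_tensor[OF f g] by blast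
    then show "foldr pderiv_at is (tensor f g) differentiable (at x)"
      unfolding eq by (blast intro: differentiableI tensor_bumps_has_derivative)
  qed
  moreover have "compact (closure {x. tensor f g x \<noteq> 0})"
    using bounded_subset[OF bounded_cbox cl] by (simp add: compact_eq_bounded_closed)
  ultimately show ?thesis
    using sub unfolding test_function_def by (intro conjI) (assumption | rule order_trans)+
qed

lemma smooth_differentiable: "smooth \<phi> \<Longrightarrow> \<phi> differentiable (at x)"
  unfolding smooth_def by (metis foldr_Nil id_apply)

lemma smooth_pderiv_at: "smooth \<phi> \<Longrightarrow> smooth (pderiv_at i \<phi>)"
  unfolding smooth_def
proof (intro allI)
  fix "is" x assume *: "\<forall>is x. foldr pderiv_at is \<phi> differentiable at x"
  have "foldr pderiv_at is (pderiv_at i \<phi>) = foldr pderiv_at (is @ [i]) \<phi>" by simp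
  then show "foldr pderiv_at is (pderiv_at i \<phi>) differentiable at x" using * by metis
qed

lemma smooth_continuous: "smooth \<phi> \<Longrightarrow> continuous_on S \<phi>"
  using smooth_differentiable differentiable_imp_continuous_within
  by (metis continuous_at_imp_continuous_on)

lemma zero_outside_closure_support: "x \<notin> closure {x. \<phi> x \<noteq> 0} \<Longrightarrow> \<phi> x = 0"
  using closure_subset[of "{x. \<phi> x \<noteq> 0}"] by auto

lemma pderiv_at_zero_outside:
  assumes "x \<notin> closure {x. \<phi> x \<noteq> 0}"
  shows "pderiv_at i \<phi> x = 0"
proof -
  have "((\<lambda>x. 0) has_derivative (\<lambda>h. 0)) (at x)" by auto
  then have "(\<phi> has_derivative (\<lambda>h. 0)) (at x)"
    by (rule has_derivative_transform_within_open[where s = "- closure {x. \<phi> x \<noteq> 0}"])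
       (use assms closure_subset in \<open>auto simp: subset_eq\<close>)
  then show ?thesis by (rule pderiv_at_eqI)
qed

lemma test_function_pderiv_at:
  assumes "test_function \<Omega> \<phi>"
  shows "test_function \<Omega> (pderiv_at i \<phi>)"
proof -
  have sub: "closure {x. pderiv_at i \<phi> x \<noteq> 0} \<subseteq> closure {x. \<phi> x \<noteq> 0}"
    by (intro closure_minimal) (auto intro: ccontr dest: pderiv_at_zero_outside[of _ \<phi> i])
  have "compact (closure {x. pderiv_at i \<phi> x \<noteq> 0})"
    using bounded_subset[OF compact_imp_bounded sub] assms
    by (simp add: compact_eq_bounded_closed test_function_def)
  with assms sub smooth_pderiv_at[of \<phi> i] show ?thesis
    unfolding test_function_def by (intro conjI) (assumption | (elim conjE, assumption) | force)+
qed

lemma test_function_outside: "test_function \<Omega> \<phi> \<Longrightarrow> x \<notin> \<Omega> \<Longrightarrow> \<phi> x = 0"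
  using closure_subset[of "{x. \<phi> x \<noteq> 0}"] unfolding test_function_def by blast

lemma test_function_continuous: "test_function \<Omega> \<phi> \<Longrightarrow> continuous_on S \<phi>"
  unfolding test_function_def using smooth_continuous by blast

lemma compactly_supported_bounded:
  fixes f :: "'a::metric_space \<Rightarrow> real"
  assumes "continuous_on UNIV f" "compact K" "\<And>x. x \<notin> K \<Longrightarrow> f x = 0"
  obtains M where "M > 0" "\<And>x. \<bar>f x\<bar> \<le> M"
proof -
  have "bounded (f ` K)"
    using assms by (intro compact_imp_bounded compact_continuous_image) (auto intro: continuous_on_subset)
  then obtain M where M: "M > 0" "\<And>x. x \<in> K \<Longrightarrow> \<bar>f x\<bar> \<le> M"
    unfolding bounded_pos by auto
  have "\<bar>f x\<bar> \<le> M" for x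
    using M assms(3)[of x] by (cases "x \<in> K") auto
  with M(1) show ?thesis by (rule that)
qed

lemma integrable_compact_support:
  fixes w :: "'a::euclidean_space \<Rightarrow> real"
  assumes "continuous_on UNIV w" "compact K" "\<And>x. x \<notin> K \<Longrightarrow> w x = 0"
  shows "integrable lborel w"
proof -
  have "integrable lborel (\<lambda>x. indicator K x *\<^sub>R w x)"
    by (rule borel_integrable_compact[OF assms(2)]) (rule continuous_on_subset[OF assms(1)], simp)
  moreover have "(\<lambda>x. indicator K x *\<^sub>R w x) = w"
    using assms(3) by (intro ext) (simp split: split_indicator)
  ultimately show ?thesis by simp
qed

text \<open>The integral of a difference quotient is 0 by translation invariance of Lebesgue measure, and
  the difference quotients converge boundedly, on a common compact set. This avoids
  iterated integrals.\<close>

lemma integral_pderiv_compact_support: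
  fixes \<psi> \<psi>' :: "'a::euclidean_space \<Rightarrow> real"
  assumes der: "\<And>x. ((\<lambda>t. \<psi> (x + t *\<^sub>R e)) has_field_derivative \<psi>' x) (at 0)"
    and cont: "continuous_on UNIV \<psi>" "continuous_on UNIV \<psi>'"
    and K: "compact K" "\<And>x. x \<notin> K \<Longrightarrow> \<psi> x = 0" "\<And>x. x \<notin> K \<Longrightarrow> \<psi>' x = 0"
  shows "(\<integral>x. \<psi>' x \<partial>lborel) = 0"
proof -
  obtain M where M: "M > 0" "\<And>x. \<bar>\<psi>' x\<bar> \<le> M"
    using compactly_supported_bounded[OF cont(2) K(1,3)] by metis
  define h where "h n = inverse (real (Suc n))" for n
  define q where "q n x = (\<psi> (x + h n *\<^sub>R e) - \<psi> x) / h n" for n x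
  have h: "0 < h n" "h n \<le> 1" for n by (auto simp: h_def field_simps)
  \<comment> \<open>contains the supports of all difference quotients\<close>
  define K' where "K' = (\<lambda>(x, t). x - t *\<^sub>R e) ` (K \<times> {0..1::real})"
  have K': "compact K'"
    unfolding K'_def
    by (auto intro!: compact_continuous_image compact_Times K(1) continuous_intros simp: case_prod_unfold)
  have int: "integrable lborel \<psi>" by (rule integrable_compact_support[OF cont(1) K(1,2)])
  have quotient: "\<exists>z. 0 < z \<and> z < 1 \<and> q n x = \<psi>' (x + z *\<^sub>R e)" for n x
  proof -
    have "((\<lambda>t. \<psi> (x + t *\<^sub>R e)) has_field_derivative \<psi>' (x + t *\<^sub>R e)) (at t)" for t
      using der[of "x + t *\<^sub>R e"] DERIV_shift[of "\<lambda>t. \<psi> (x + t *\<^sub>R e)" _ 0 t]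
      by (simp add: algebra_simps)
    then obtain z where "0 < z" "z < h n" "\<psi> (x + h n *\<^sub>R e) - \<psi> x = h n * \<psi>' (x + z *\<^sub>R e)"
      using MVT2[of 0 "h n" "\<lambda>t. \<psi> (x + t *\<^sub>R e)" "\<lambda>t. \<psi>' (x + t *\<^sub>R e)"] h(1)[of n]
      by auto
    with h[of n] show ?thesis by (intro exI[of _ z]) (auto simp: q_def)
  qed
  have lim: "(\<lambda>n. q n x) \<longlonglongrightarrow> \<psi>' x" for x
  proof -
    have "filterlim h (at 0) sequentially"
      unfolding filterlim_at
    proof (intro conjI always_eventually allI)
      show "h \<longlonglongrightarrow> 0" unfolding h_def by (rule LIMSEQ_inverse_real_of_nat)
    qed (use h in \<open>auto simp: less_le\<close>)
    moreover have "((\<lambda>t. (\<psi> (x + t *\<^sub>R e) - \<psi> x) / t) \<longlongrightarrow> \<psi>' x) (at 0)"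
      using der[of x] by (simp add: DERIV_def)
    ultimately show ?thesis unfolding q_def by (rule filterlim_compose[rotated])
  qed
  have "(\<lambda>n. \<integral>x. q n x \<partial>lborel) \<longlonglongrightarrow> (\<integral>x. \<psi>' x \<partial>lborel)"
  proof (rule integral_dominated_convergence[where w = "\<lambda>x. M * indicator K' x"])
    have "K' \<in> sets lborel" using compact_imp_closed[OF K'] by simp
    moreover have "emeasure lborel K' < \<infinity>"
      using emeasure_bounded_finite[OF compact_imp_bounded[OF K']] by simp
    ultimately show "integrable lborel (\<lambda>x. M * indicator K' x)"
      by (intro integrable_mult_right integrable_real_indicator)
    show "AE x in lborel. (\<lambda>n. q n x) \<longlonglongrightarrow> \<psi>' x" using lim by simp
    show "AE x in lborel. norm (q n x) \<le> M * indicator K' x" for n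
    proof (intro AE_I2)
      fix x
      obtain z where z: "0 < z" "z < 1" "q n x = \<psi>' (x + z *\<^sub>R e)" using quotient by blast
      show "norm (q n x) \<le> M * indicator K' x"
      proof (cases "x + z *\<^sub>R e \<in> K")
        case True
        then have "x \<in> K'" unfolding K'_def
          using z by (intro image_eqI[of _ _ "(x + z *\<^sub>R e, z)"]) auto
        then show ?thesis using z M by simp
      qed (use z K(3) M in auto)
    qed
    show "\<psi>' \<in> borel_measurable lborel" using cont by (simp add: borel_measurable_continuous_onI)
    show "q n \<in> borel_measurable lborel" for n
    proof -
      have "continuous_on UNIV (\<lambda>x. \<psi> (x + h n *\<^sub>R e))"
        by (rule continuous_on_compose2[OF cont(1)]) (auto intro!: continuous_intros)
      then have "continuous_on UNIV (q n)"
        unfolding q_def using h(1)[of n] cont(1) by (intro continuous_on_divide continuous_on_diff) auto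
      then show ?thesis by (simp add: borel_measurable_continuous_onI)
    qed
  qed
  moreover have "(\<integral>x. q n x \<partial>lborel) = 0" for n
  proof -
    have m: "\<psi> \<in> borel_measurable borel" using cont by (simp add: borel_measurable_continuous_onI)
    have "integrable (distr lborel borel ((+) (h n *\<^sub>R e))) \<psi>"
      unfolding lborel_distr_plus by (rule int)
    then have int': "integrable lborel (\<lambda>x. \<psi> (x + h n *\<^sub>R e))"
      using m by (subst (asm) integrable_distr_eq) (auto simp: add.commute)
    have "(\<integral>x. \<psi> x \<partial>lborel) = (\<integral>x. \<psi> x \<partial>(distr lborel borel ((+) (h n *\<^sub>R e))))"
      unfolding lborel_distr_plus ..
    also have "\<dots> = (\<integral>x. \<psi> (x + h n *\<^sub>R e) \<partial>lborel)"
      using m by (subst integral_distr) (auto simp: add.commute)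
    finally show ?thesis unfolding q_def using int int' by simp
  qed
  ultimately show ?thesis by (simp add: LIMSEQ_const_iff)
qed

section \<open>Integration by parts against quadratic polynomials\<close>

text \<open>The coefficients are normalised so that \<open>A\<close>, \<open>B\<close>, \<open>C\<close> are the second derivatives. Both
  partial derivatives are then again of this form, with \<open>A\<close>, \<open>B\<close>, \<open>C\<close> shifted into the
  places of the linear coefficients.\<close>

definition quadratic :: "real \<Rightarrow> real \<Rightarrow> real \<Rightarrow> real \<Rightarrow> real \<Rightarrow> real \<Rightarrow> real^2 \<Rightarrow> real" where
  "quadratic A B C a b c x =
     A / 2 * (x $ 1)\<^sup>2 + B * (x $ 1 * x $ 2) + C / 2 * (x $ 2)\<^sup>2 + a * x $ 1 + b * x $ 2 + c"

lemma quadratic_line_derivative: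
  "((\<lambda>t. quadratic A B C a b c (x + t *\<^sub>R axis 1 1)) has_field_derivative quadratic 0 0 0 A B a x) (at 0)"
  "((\<lambda>t. quadratic A B C a b c (x + t *\<^sub>R axis 2 1)) has_field_derivative quadratic 0 0 0 B C b x) (at 0)"
  unfolding quadratic_def
  by (auto simp: axis_def field_simps intro!: derivative_eq_intros)

lemma continuous_on_quadratic: "continuous_on S (quadratic A B C a b c)"
  unfolding quadratic_def[abs_def] by (intro continuous_intros)

lemma test_function_line_derivative:
  assumes "test_function \<Omega> \<phi>"
  shows "((\<lambda>t. \<phi> (x + t *\<^sub>R axis i 1)) has_field_derivative pderiv_at i \<phi> x) (at 0)"
proof -
  have "(\<phi> has_derivative frechet_derivative \<phi> (at x)) (at x)"
    using assms smooth_differentiable frechet_derivative_works unfolding test_function_def by blast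
  then have "(\<phi> has_derivative frechet_derivative \<phi> (at x)) (at (x + 0 *\<^sub>R axis i 1))" by simp
  then have "((\<lambda>t. \<phi> (x + t *\<^sub>R axis i 1)) has_derivative
      (\<lambda>h. frechet_derivative \<phi> (at x) (h *\<^sub>R axis i 1))) (at 0)"
    by (rule has_derivative_compose[rotated]) (auto intro!: derivative_eq_intros)
  moreover have "frechet_derivative \<phi> (at x) (h *\<^sub>R axis i 1) = h * pderiv_at i \<phi> x" for h
    using linear_frechet_derivative[of \<phi> "at x"] assms smooth_differentiable[of \<phi> x]
    by (simp add: pderiv_at_def linear_cmul test_function_def)
  ultimately show ?thesis by (simp add: has_field_derivative_def mult.commute[of _ "pderiv_at i \<phi> x"])
qed

lemma fun_distr_continuous:
  assumes "open \<Omega>" "test_function \<Omega> \<phi>" "continuous_on UNIV v"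
  shows "fun_distr \<Omega> v \<phi> = (\<integral>x. v x * \<phi> x \<partial>lborel)"
proof -
  have "fun_distr \<Omega> v \<phi> = (\<integral>x. indicator \<Omega> x *\<^sub>R (v x * \<phi> x) \<partial>lebesgue)"
    unfolding fun_distr_def using assms(1)
    by (intro integral_restrict_space) auto
  also have "(\<lambda>x. indicator \<Omega> x *\<^sub>R (v x * \<phi> x)) = (\<lambda>x. v x * \<phi> x)"
    using test_function_outside[OF assms(2)] by (intro ext) (simp split: split_indicator)
  also have "(\<integral>x. v x * \<phi> x \<partial>lebesgue) = (\<integral>x. v x * \<phi> x \<partial>lborel)"
    using assms(3) test_function_continuous[OF assms(2), of UNIV]
    by (intro integral_completion) (simp add: borel_measurable_continuous_onI continuous_on_mult)
  finally show ?thesis .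
qed

lemma fun_distr_integration_by_parts:
  assumes \<Omega>: "open \<Omega>" and \<phi>: "test_function \<Omega> \<phi>"
    and v: "continuous_on UNIV v" "continuous_on UNIV v'"
    and der: "\<And>x. ((\<lambda>t. v (x + t *\<^sub>R axis i 1)) has_field_derivative v' x) (at 0)"
  shows "fun_distr \<Omega> v (pderiv_at i \<phi>) = - fun_distr \<Omega> v' \<phi>"
proof -
  note \<phi>' = test_function_pderiv_at[OF \<phi>, of i]
  define K where "K = closure {x. \<phi> x \<noteq> 0}"
  have K: "compact K" using \<phi> by (auto simp: test_function_def K_def)
  have K0: "\<phi> x = 0" if "x \<notin> K" for x
    using that zero_outside_closure_support by (auto simp: K_def)
  have K1: "pderiv_at i \<phi> x = 0" if "x \<notin> K" for x
    using that pderiv_at_zero_outside by (auto simp: K_def)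
  have cont: "continuous_on UNIV \<phi>" "continuous_on UNIV (pderiv_at i \<phi>)"
    using \<phi> \<phi>' test_function_continuous by blast+
  have "(\<integral>x. v' x * \<phi> x + pderiv_at i \<phi> x * v x \<partial>lborel) = 0"
  proof (rule integral_pderiv_compact_support[where e = "axis i 1" and K = K and \<psi> = "\<lambda>x. v x * \<phi> x"])
    show "((\<lambda>t. v (x + t *\<^sub>R axis i 1) * \<phi> (x + t *\<^sub>R axis i 1)) has_real_derivative
        v' x * \<phi> x + pderiv_at i \<phi> x * v x) (at 0)" for x
      using DERIV_mult[OF der test_function_line_derivative[OF \<phi>], of x x i] by simp
  qed (use K K0 K1 cont v in \<open>auto intro!: continuous_intros\<close>)
  moreover have "integrable lborel (\<lambda>x. v' x * \<phi> x)" "integrable lborel (\<lambda>x. pderiv_at i \<phi> x * v x)"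
    using K K0 K1 v cont
    by (auto intro!: integrable_compact_support[where K = K] continuous_on_mult)
  ultimately have "(\<integral>x. v x * pderiv_at i \<phi> x \<partial>lborel) = - (\<integral>x. v' x * \<phi> x \<partial>lborel)"
    by (simp add: mult.commute)
  then show ?thesis
    by (simp add: fun_distr_continuous[OF \<Omega> \<phi> v(2)] fun_distr_continuous[OF \<Omega> \<phi>' v(1)])
qed

lemma fun_distr_quadratic_pderiv_at:
  assumes "open \<Omega>" "test_function \<Omega> \<phi>"
  shows "fun_distr \<Omega> (quadratic A B C a b c) (pderiv_at 1 \<phi>) = - fun_distr \<Omega> (quadratic 0 0 0 A B a) \<phi>"
    "fun_distr \<Omega> (quadratic A B C a b c) (pderiv_at 2 \<phi>) = - fun_distr \<Omega> (quadratic 0 0 0 B C b) \<phi>"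
  by (intro fun_distr_integration_by_parts[OF assms] continuous_on_quadratic quadratic_line_derivative)+

lemma integrable_mult_test_function:
  assumes "open \<Omega>" "test_function \<Omega> \<phi>" "integrable (lebesgue_on \<Omega>) v"
  shows "integrable (lebesgue_on \<Omega>) (\<lambda>x. v x * \<phi> x)"
proof -
  have "\<phi> x = 0" if "x \<notin> closure {x. \<phi> x \<noteq> 0}" for x
    using that by (rule zero_outside_closure_support)
  then obtain M where M: "M > 0" "\<And>x. \<bar>\<phi> x\<bar> \<le> M"
    using compactly_supported_bounded[OF test_function_continuous[OF assms(2)], of "closure {x. \<phi> x \<noteq> 0}"] assms(2)
    unfolding test_function_def by metis
  have "\<phi> \<in> borel_measurable (lebesgue_on \<Omega>)"
    using assms test_function_continuous[OF assms(2)]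
    by (intro continuous_imp_measurable_on_sets_lebesgue) auto
  then show ?thesis
    using assms(3) M(2)
    by (intro Bochner_Integration.integrable_bound[OF integrable_mult_right[OF assms(3), of M]])
       (auto simp: abs_mult mult.commute[of M] intro!: mult_left_mono order_trans[OF M(2)])
qed

lemma fun_distr_linear:
  assumes "open \<Omega>" "integrable (lebesgue_on \<Omega>) v" "test_function \<Omega> \<phi>" "test_function \<Omega> \<psi>"
  shows "fun_distr \<Omega> v (\<lambda>x. \<phi> x - k * \<psi> x) = fun_distr \<Omega> v \<phi> - k * fun_distr \<Omega> v \<psi>"
proof -
  have "(\<lambda>x. v x * (\<phi> x - k * \<psi> x)) = (\<lambda>x. v x * \<phi> x - k * (v x * \<psi> x))"
    by (auto simp: algebra_simps)
  then show ?thesis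
    using assms by (simp add: fun_distr_def integrable_mult_test_function)
qed

section \<open>Functionals that vanish on derivatives\<close>

text \<open>One identity per argument expresses additivity and homogeneity together, in the
  form in which it is used: subtraction of a multiple of a reference bump.\<close>

definition bilinear_on_bumps ::
    "real \<Rightarrow> real \<Rightarrow> real \<Rightarrow> real \<Rightarrow> ((real \<Rightarrow> real) \<Rightarrow> (real \<Rightarrow> real) \<Rightarrow> real) \<Rightarrow> bool" where
  "bilinear_on_bumps a b c d T \<longleftrightarrow>
     (\<forall>f\<in>bumps a b. \<forall>h\<in>bumps a b. \<forall>g\<in>bumps c d. \<forall>k.
        T (\<lambda>x. f x - k * h x) g = T f g - k * T h g) \<and>
     (\<forall>f\<in>bumps a b. \<forall>g\<in>bumps c d. \<forall>h\<in>bumps c d. \<forall>k.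
        T f (\<lambda>x. g x - k * h x) = T f g - k * T f h)"

lemma deriv_diff_cmult:
  assumes "f \<in> bumps a b" "h \<in> bumps a b"
  shows "deriv (\<lambda>x. f x - k * h x) = (\<lambda>x. deriv f x - k * deriv h x)"
  by (rule deriv_eqI) (intro DERIV_diff DERIV_cmult bumps_deriv[OF assms(1)] bumps_deriv[OF assms(2)])

lemma bilinear_on_bumps_deriv:
  assumes "bilinear_on_bumps a b c d T"
  shows "bilinear_on_bumps a b c d (\<lambda>f g. T (deriv f) g)"
    "bilinear_on_bumps a b c d (\<lambda>f g. T f (deriv g))"
  using assms unfolding bilinear_on_bumps_def
  by (simp_all add: deriv_diff_cmult deriv_in_bumps)

lemma bilinear_on_bumps_add:
  assumes "bilinear_on_bumps a b c d T" "bilinear_on_bumps a b c d S"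
  shows "bilinear_on_bumps a b c d (\<lambda>f g. T f g + S f g)"
  using assms unfolding bilinear_on_bumps_def by (simp add: algebra_simps)

lemma bilinear_on_bumps_diff:
  assumes "bilinear_on_bumps a b c d T" "bilinear_on_bumps a b c d S"
  shows "bilinear_on_bumps a b c d (\<lambda>f g. T f g - S f g)"
  using assms unfolding bilinear_on_bumps_def by (simp add: algebra_simps)

lemma bilinear_on_bumps_fun_distr:
  assumes "open \<Omega>" "integrable (lebesgue_on \<Omega>) v"
    and sub: "cbox (vector [a, c]) (vector [b, d]) \<subseteq> \<Omega>"
  shows "bilinear_on_bumps a b c d (\<lambda>f g. fun_distr \<Omega> v (tensor f g))"
proof -
  have "tensor (\<lambda>x. f x - k * h x) g = (\<lambda>x. tensor f g x - k * tensor h g x)"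
    "tensor f (\<lambda>x. g x - k * h x) = (\<lambda>x. tensor f g x - k * tensor f h x)" for f g h k
    by (auto simp: tensor_def algebra_simps)
  then show ?thesis
    unfolding bilinear_on_bumps_def
    using fun_distr_linear[OF assms(1,2)] test_function_tensor[OF _ _ sub] by simp
qed

lemma bump_integral_nonzero:
  assumes "a < b"
  obtains \<theta> where "\<theta> \<in> bumps a b" "integral {a..b} \<theta> \<noteq> 0" "\<And>t. \<theta> t \<ge> 0" "\<And>t. t \<in> {a<..<b} \<Longrightarrow> \<theta> t > 0"
proof -
  obtain \<theta> where \<theta>: "\<theta> \<in> bumps a b" "\<And>t. \<theta> t \<ge> 0" "\<And>t. t \<in> {a<..<b} \<Longrightarrow> \<theta> t > 0"
    using that bumps_approx_interval(1,2,4)[OF assms, where n = 0] by blast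
  have "\<theta> ((a + b) / 2) > 0" using \<theta>(3) assms by (simp add: field_simps)
  then have "integral {a..b} \<theta> \<noteq> 0"
    using integral_eq_0_iff[of a b \<theta>] bumps_continuous[OF \<theta>(1)] \<theta>(2) assms
    by (force simp: field_simps)
  with \<theta> show ?thesis using that by blast
qed

text \<open>Modulo derivatives of bumps the space of bumps is one-dimensional, with the integral as
  coordinate.\<close>

lemma bumps_decompose:
  assumes f: "f \<in> bumps a b" and \<theta>: "\<theta> \<in> bumps a b" "integral {a..b} \<theta> \<noteq> 0" and "a < b"
  shows "\<exists>F\<in>bumps a b. (\<lambda>x. f x - integral {a..b} f / integral {a..b} \<theta> * \<theta> x) = deriv F"
proof -
  define k where "k = integral {a..b} f / integral {a..b} \<theta>"
  have int: "h integrable_on {a..b}" if "h \<in> bumps a b" for h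
    by (intro integrable_continuous_real bumps_continuous[OF that])
  have "integral {a..b} (\<lambda>x. f x - k * \<theta> x) = integral {a..b} f - k * integral {a..b} \<theta>"
    using int[OF f] integrable_on_mult_right[OF int[OF \<theta>(1)], of k]
    by (simp add: Henstock_Kurzweil_Integration.integral_diff)
  also have "\<dots> = 0" using \<theta> by (simp add: k_def)
  finally show ?thesis
    using bumps_primitive[OF bumps_diff_cmult[OF f \<theta>(1), of k]] \<open>a < b\<close>
    unfolding k_def[symmetric] by force
qed

lemma bilinear_killed_by_deriv:
  assumes "a < b" "c < d" and bil: "bilinear_on_bumps a b c d T"
    and kill1: "\<And>f g. f \<in> bumps a b \<Longrightarrow> g \<in> bumps c d \<Longrightarrow> T (deriv f) g = 0"
    and kill2: "\<And>f g. f \<in> bumps a b \<Longrightarrow> g \<in> bumps c d \<Longrightarrow> T f (deriv g) = 0"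
  shows "\<exists>K. \<forall>f\<in>bumps a b. \<forall>g\<in>bumps c d. T f g = K * (integral {a..b} f * integral {c..d} g)"
proof -
  obtain \<theta> where \<theta>: "\<theta> \<in> bumps a b" "integral {a..b} \<theta> \<noteq> 0"
    using bump_integral_nonzero[OF \<open>a < b\<close>] by metis
  obtain \<eta> where \<eta>: "\<eta> \<in> bumps c d" "integral {c..d} \<eta> \<noteq> 0"
    using bump_integral_nonzero[OF \<open>c < d\<close>] by metis
  have "T f g = T \<theta> \<eta> / (integral {a..b} \<theta> * integral {c..d} \<eta>) * (integral {a..b} f * integral {c..d} g)"
    if f: "f \<in> bumps a b" and g: "g \<in> bumps c d" for f g
  proof -
    define k l where "k = integral {a..b} f / integral {a..b} \<theta>" and "l = integral {c..d} g / integral {c..d} \<eta>"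
    have "T (\<lambda>x. f x - k * \<theta> x) g = 0"
      using bumps_decompose[OF f \<theta> \<open>a < b\<close>] kill1[OF _ g] unfolding k_def by auto
    then have "T f g = k * T \<theta> g"
      using bil f g \<theta>(1) unfolding bilinear_on_bumps_def by auto
    moreover have "T \<theta> (\<lambda>x. g x - l * \<eta> x) = 0"
      using bumps_decompose[OF g \<eta> \<open>c < d\<close>] kill2[OF \<theta>(1)] unfolding l_def by auto
    then have "T \<theta> g = l * T \<theta> \<eta>"
      using bil g \<theta>(1) \<eta>(1) unfolding bilinear_on_bumps_def by auto
    ultimately show ?thesis by (simp add: k_def l_def)
  qed
  then show ?thesis by blast
qed

lemma integrable_continuous_bounded_open:
  fixes v :: "real^2 \<Rightarrow> real"
  assumes "open \<Omega>" "bounded \<Omega>" "continuous_on UNIV v"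
  shows "integrable (lebesgue_on \<Omega>) v" "integrable (restrict_space lborel \<Omega>) v"
proof -
  have K: "compact (closure \<Omega>)" using assms by (simp add: compact_closure)
  have "integrable lborel (\<lambda>x. indicator (closure \<Omega>) x *\<^sub>R v x)"
    by (rule borel_integrable_compact[OF K]) (rule continuous_on_subset[OF assms(3)], simp)
  then have "integrable lborel (\<lambda>x. indicator \<Omega> x *\<^sub>R (indicator (closure \<Omega>) x *\<^sub>R v x))"
    by (rule integrable_mult_indicator[rotated]) (use assms(1) in simp)
  moreover have "(\<lambda>x. indicator \<Omega> x *\<^sub>R (indicator (closure \<Omega>) x *\<^sub>R v x)) = (\<lambda>x. indicator \<Omega> x *\<^sub>R v x)"
    using closure_subset[of \<Omega>] by (intro ext) (auto split: split_indicator)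
  ultimately have *: "integrable lborel (\<lambda>x. indicator \<Omega> x *\<^sub>R v x)" by simp
  then show "integrable (restrict_space lborel \<Omega>) v"
    using assms(1) by (subst integrable_restrict_space) auto
  have "integrable lebesgue (\<lambda>x. indicator \<Omega> x *\<^sub>R v x)"
    using * by (subst integrable_completion) auto
  then show "integrable (lebesgue_on \<Omega>) v"
    using assms(1) by (subst integrable_restrict_space) auto
qed

lemma integrable_quadratic:
  "open \<Omega> \<Longrightarrow> bounded \<Omega> \<Longrightarrow> integrable (lebesgue_on \<Omega>) (quadratic A B C a b c)"
  by (intro integrable_continuous_bounded_open(1) continuous_on_quadratic)

text \<open>The constants have to be compared with the pairing of the constant function 1. That it is
  not identically 0 is all that is needed, so the identification with a
  product of integrals is not proved by Fubini.\<close>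

lemma fun_distr_one_tensor_pos:
  assumes "open \<Omega>" "bounded \<Omega>" "a < b" "c < d" and sub: "cbox (vector [a, c]) (vector [b, d]) \<subseteq> \<Omega>"
  shows "\<exists>\<theta>\<in>bumps a b. \<exists>\<eta>\<in>bumps c d. fun_distr \<Omega> (quadratic 0 0 0 0 0 1) (tensor \<theta> \<eta>) \<noteq> 0"
proof -
  obtain \<theta> where \<theta>: "\<theta> \<in> bumps a b" "\<And>t. \<theta> t \<ge> 0" "\<And>t. t \<in> {a<..<b} \<Longrightarrow> \<theta> t > 0"
    using bump_integral_nonzero[OF \<open>a < b\<close>] by metis
  obtain \<eta> where \<eta>: "\<eta> \<in> bumps c d" "\<And>t. \<eta> t \<ge> 0" "\<And>t. t \<in> {c<..<d} \<Longrightarrow> \<eta> t > 0"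
    using bump_integral_nonzero[OF \<open>c < d\<close>] by metis
  have q: "quadratic 0 0 0 0 0 1 x * tensor \<theta> \<eta> x = tensor \<theta> \<eta> x" for x by (simp add: quadratic_def)
  have int: "integrable (lebesgue_on \<Omega>) (tensor \<theta> \<eta>)"
    using integrable_mult_test_function[OF assms(1) test_function_tensor[OF \<theta>(1) \<eta>(1) sub]
        integrable_quadratic[OF assms(1,2), of 0 0 0 0 0 1]] by (simp add: q)
  have False if "fun_distr \<Omega> (quadratic 0 0 0 0 0 1) (tensor \<theta> \<eta>) = 0"
  proof -
    have nonneg: "AE x in lebesgue_on \<Omega>. 0 \<le> tensor \<theta> \<eta> x"
      using \<theta>(2) \<eta>(2) by (simp add: tensor_def)
    have "(\<integral>x. tensor \<theta> \<eta> x \<partial>lebesgue_on \<Omega>) = 0" using that by (simp add: fun_distr_def q)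
    then have "AE x in lebesgue_on \<Omega>. tensor \<theta> \<eta> x = 0"
      using integral_nonneg_eq_0_iff_AE[OF int] nonneg by simp
    then have "AE x in lebesgue. x \<in> \<Omega> \<longrightarrow> tensor \<theta> \<eta> x = 0"
      using assms(1) by (simp add: AE_restrict_space_iff)
    then have "negligible {x. \<not> (x \<in> \<Omega> \<longrightarrow> tensor \<theta> \<eta> x = 0)}"
      unfolding eventually_ae_filter_negligible using negligible_subset by blast
    moreover have "box (vector [a, c]) (vector [b, d]) \<subseteq> {x. \<not> (x \<in> \<Omega> \<longrightarrow> tensor \<theta> \<eta> x = 0)}"
    proof
      fix x :: "real^2" assume x: "x \<in> box (vector [a, c]) (vector [b, d])"
      then have "x \<in> \<Omega>" using sub box_subset_cbox by blast
      moreover have "tensor \<theta> \<eta> x > 0"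
        using x \<theta>(3) \<eta>(3) by (auto simp: tensor_def mem_box_cart forall_2)
      ultimately show "x \<in> {x. \<not> (x \<in> \<Omega> \<longrightarrow> tensor \<theta> \<eta> x = 0)}" by simp
    qed
    ultimately have "negligible (box (vector [a, c]) (vector [b, d]) :: (real^2) set)"
      by (rule negligible_subset)
    moreover have "box (vector [a, c]) (vector [b, d]) \<noteq> ({} :: (real^2) set)"
      using \<open>a < b\<close> \<open>c < d\<close> by (simp add: interval_ne_empty_cart forall_2)
    ultimately show False using open_not_negligible open_box by blast
  qed
  with \<theta>(1) \<eta>(1) show ?thesis by blast
qed

text \<open>The functionals \<open>(f, g) \<mapsto> P f'' g\<close>, \<open>P f' g'\<close> and \<open>P f g''\<close> vanish on derivatives by
  assumption, so they are constants \<open>A\<close>, \<open>B\<close>, \<open>C\<close> times the pairing with 1. Subtracting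
  the linear functions with these derivatives, the functionals \<open>P f' g\<close> and \<open>P f g'\<close> become
  constants too, and then so does \<open>P\<close> itself. The signs come from the integration by parts.\<close>

lemma weakly_quadratic_on_box:
  assumes \<Omega>: "open \<Omega>" "bounded \<Omega>" and u: "integrable (lebesgue_on \<Omega>) u"
    and ab: "a < b" and cd: "c < d" and sub: "cbox (vector [a, c]) (vector [b, d]) \<subseteq> \<Omega>"
    and P: "P = (\<lambda>f g. fun_distr \<Omega> u (tensor f g))"
    and third: "\<And>f g. f \<in> bumps a b \<Longrightarrow> g \<in> bumps c d \<Longrightarrow>
      P (deriv (deriv (deriv f))) g = 0 \<and> P (deriv (deriv f)) (deriv g) = 0 \<and>
      P (deriv f) (deriv (deriv g)) = 0 \<and> P f (deriv (deriv (deriv g))) = 0"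
  shows "\<exists>A B C p q r. (\<forall>f\<in>bumps a b. \<forall>g\<in>bumps c d.
      P f g = fun_distr \<Omega> (quadratic A B C p q r) (tensor f g))"
proof -
  define Q where "Q A B C p q r f g = fun_distr \<Omega> (quadratic A B C p q r) (tensor f g)" for A B C p q r f g
  have bilP: "bilinear_on_bumps a b c d P"
    unfolding P by (rule bilinear_on_bumps_fun_distr[OF \<Omega>(1) u sub])
  have bilQ: "bilinear_on_bumps a b c d (Q A B C p q r)" for A B C p q r
    unfolding Q_def by (intro bilinear_on_bumps_fun_distr[OF \<Omega>(1) integrable_quadratic[OF \<Omega>] sub])
  have Q1: "Q A B C p q r (deriv f) g = - Q 0 0 0 A B p f g"
    and Q2: "Q A B C p q r f (deriv g) = - Q 0 0 0 B C q f g"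
    if "f \<in> bumps a b" "g \<in> bumps c d" for A B C p q r f g
    using fun_distr_quadratic_pderiv_at[OF \<Omega>(1) test_function_tensor[OF that sub], of A B C p q r]
    by (simp_all add: Q_def pderiv_at_tensor[OF that])
  have Q0: "Q 0 0 0 0 0 0 f g = 0" for f g
    by (simp add: Q_def fun_distr_def quadratic_def)
  have Qr: "Q A B C p q r f g = Q A B C p q 0 f g + Q 0 0 0 0 0 r f g"
    "Q 0 0 0 0 0 r f g = r * Q 0 0 0 0 0 1 f g"
    if "f \<in> bumps a b" "g \<in> bumps c d" for A B C p q r f g
  proof -
    have "integrable (lebesgue_on \<Omega>) (\<lambda>x. quadratic A B C p q r x * tensor f g x)" for A B C p q r
      by (intro integrable_mult_test_function[OF \<Omega>(1) test_function_tensor[OF that sub]] integrable_quadratic[OF \<Omega>])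
    note * = this[of A B C p q 0] this[of 0 0 0 0 0 r]
    have "quadratic A B C p q r x * tensor f g x =
        quadratic A B C p q 0 x * tensor f g x + quadratic 0 0 0 0 0 r x * tensor f g x" for x
      by (simp add: quadratic_def algebra_simps)
    then show "Q A B C p q r f g = Q A B C p q 0 f g + Q 0 0 0 0 0 r f g"
      using * by (simp add: Q_def fun_distr_def)
    have eq: "(\<lambda>x. quadratic 0 0 0 0 0 r x * tensor f g x) =
        (\<lambda>x. r * (quadratic 0 0 0 0 0 1 x * tensor f g x))"
      by (simp add: quadratic_def)
    then show "Q 0 0 0 0 0 r f g = r * Q 0 0 0 0 0 1 f g"
      unfolding Q_def fun_distr_def eq by simp
  qed
  obtain K1 where K1: "\<And>f g. f \<in> bumps a b \<Longrightarrow> g \<in> bumps c d \<Longrightarrow>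
      Q 0 0 0 0 0 1 f g = K1 * (integral {a..b} f * integral {c..d} g)"
    using bilinear_killed_by_deriv[OF ab cd bilQ[of 0 0 0 0 0 1]] by (auto simp: Q1 Q2 Q0)
  have "K1 \<noteq> 0"
    using fun_distr_one_tensor_pos[OF \<Omega> ab cd sub] K1 unfolding Q_def by fastforce
  have const: "\<exists>r. \<forall>f\<in>bumps a b. \<forall>g\<in>bumps c d. T f g = Q 0 0 0 0 0 r f g"
    if "bilinear_on_bumps a b c d T" "\<And>f g. f \<in> bumps a b \<Longrightarrow> g \<in> bumps c d \<Longrightarrow> T (deriv f) g = 0"
      "\<And>f g. f \<in> bumps a b \<Longrightarrow> g \<in> bumps c d \<Longrightarrow> T f (deriv g) = 0" for T
  proof -
    from bilinear_killed_by_deriv[OF ab cd that] obtain K where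
      "\<forall>f\<in>bumps a b. \<forall>g\<in>bumps c d. T f g = K * (integral {a..b} f * integral {c..d} g)" by blast
    then show ?thesis
      using \<open>K1 \<noteq> 0\<close> by (intro exI[of _ "K / K1"]) (simp add: Qr(2)[of _ _ "K / K1"] K1)
  qed
  obtain A where A: "\<And>f g. f \<in> bumps a b \<Longrightarrow> g \<in> bumps c d \<Longrightarrow> P (deriv (deriv f)) g = Q 0 0 0 0 0 A f g"
    using const[of "\<lambda>f g. P (deriv (deriv f)) g"] third
      bilinear_on_bumps_deriv(1)[OF bilinear_on_bumps_deriv(1)[OF bilP]] by auto
  obtain B where B: "\<And>f g. f \<in> bumps a b \<Longrightarrow> g \<in> bumps c d \<Longrightarrow> P (deriv f) (deriv g) = Q 0 0 0 0 0 B f g"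
    using const[of "\<lambda>f g. P (deriv f) (deriv g)"] third
      bilinear_on_bumps_deriv(2)[OF bilinear_on_bumps_deriv(1)[OF bilP]] by auto
  obtain C where C: "\<And>f g. f \<in> bumps a b \<Longrightarrow> g \<in> bumps c d \<Longrightarrow> P f (deriv (deriv g)) = Q 0 0 0 0 0 C f g"
    using const[of "\<lambda>f g. P f (deriv (deriv g))"] third
      bilinear_on_bumps_deriv(2)[OF bilinear_on_bumps_deriv(2)[OF bilP]] by auto
  have neg: "Q 0 0 0 0 0 (- r) f g = - Q 0 0 0 0 0 r f g" if "f \<in> bumps a b" "g \<in> bumps c d" for r f g
    using Qr(2)[OF that, of r] Qr(2)[OF that, of "- r"] by simp
  have "\<exists>r. \<forall>f\<in>bumps a b. \<forall>g\<in>bumps c d. P (deriv f) g + Q 0 0 0 A B 0 f g = Q 0 0 0 0 0 r f g"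
    by (rule const[of "\<lambda>f g. P (deriv f) g + Q 0 0 0 A B 0 f g",
          OF bilinear_on_bumps_add[OF bilinear_on_bumps_deriv(1)[OF bilP] bilQ]])
       (simp_all add: Q1 Q2 A B deriv_in_bumps)
  then obtain p' where p': "\<And>f g. f \<in> bumps a b \<Longrightarrow> g \<in> bumps c d \<Longrightarrow>
      P (deriv f) g + Q 0 0 0 A B 0 f g = Q 0 0 0 0 0 p' f g" by blast
  define p where "p = - p'"
  have p: "P (deriv f) g = - Q 0 0 0 A B p f g" if "f \<in> bumps a b" "g \<in> bumps c d" for f g
    using p'[OF that] Qr(1)[OF that, of 0 0 0 A B p] neg[OF that, of p'] by (simp add: p_def)
  have "\<exists>r. \<forall>f\<in>bumps a b. \<forall>g\<in>bumps c d. P f (deriv g) + Q 0 0 0 B C 0 f g = Q 0 0 0 0 0 r f g"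
    by (rule const[of "\<lambda>f g. P f (deriv g) + Q 0 0 0 B C 0 f g",
          OF bilinear_on_bumps_add[OF bilinear_on_bumps_deriv(2)[OF bilP] bilQ]])
       (simp_all add: Q1 Q2 B C deriv_in_bumps)
  then obtain q' where q': "\<And>f g. f \<in> bumps a b \<Longrightarrow> g \<in> bumps c d \<Longrightarrow>
      P f (deriv g) + Q 0 0 0 B C 0 f g = Q 0 0 0 0 0 q' f g" by blast
  define q where "q = - q'"
  have q: "P f (deriv g) = - Q 0 0 0 B C q f g" if "f \<in> bumps a b" "g \<in> bumps c d" for f g
    using q'[OF that] Qr(1)[OF that, of 0 0 0 B C q] neg[OF that, of q'] by (simp add: q_def)
  have "\<exists>r. \<forall>f\<in>bumps a b. \<forall>g\<in>bumps c d. P f g - Q A B C p q 0 f g = Q 0 0 0 0 0 r f g"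
    by (rule const[of "\<lambda>f g. P f g - Q A B C p q 0 f g", OF bilinear_on_bumps_diff[OF bilP bilQ]])
       (simp_all add: Q1 Q2 p q)
  then obtain r where "\<And>f g. f \<in> bumps a b \<Longrightarrow> g \<in> bumps c d \<Longrightarrow> P f g - Q A B C p q 0 f g = Q 0 0 0 0 0 r f g"
    by blast
  then have "\<forall>f\<in>bumps a b. \<forall>g\<in>bumps c d. P f g = Q A B C p q r f g"
    using Qr(1)[of _ _ A B C p q r] by (simp add: diff_eq_eq add.commute)
  then show ?thesis unfolding Q_def by blast
qed

section \<open>From weak to almost everywhere identities\<close>

lemma integral_subbox_eq_0:
  assumes \<Omega>: "open \<Omega>" and v: "integrable (lebesgue_on \<Omega>) v"
    and sub: "cbox p q \<subseteq> \<Omega>" and pq: "p $ 1 < q $ 1" "p $ 2 < q $ 2"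
    and 0: "\<And>f g. f \<in> bumps (p $ 1) (q $ 1) \<Longrightarrow> g \<in> bumps (p $ 2) (q $ 2) \<Longrightarrow>
      fun_distr \<Omega> v (tensor f g) = 0"
  shows "integral (cbox p q) v = 0"
proof -
  have box: "box p q \<subseteq> \<Omega>" using sub box_subset_cbox by blast
  define F where "F n t = flat_exp 1 (real (Suc n) * (t - p $ 1)) * flat_exp 1 (real (Suc n) * (q $ 1 - t))" for n t
  define G where "G n t = flat_exp 1 (real (Suc n) * (t - p $ 2)) * flat_exp 1 (real (Suc n) * (q $ 2 - t))" for n t
  note F = bumps_approx_interval[OF pq(1), folded F_def]
  note G = bumps_approx_interval[OF pq(2), folded G_def]
  have eq: "vector [p $ 1, p $ 2] = p" "vector [q $ 1, q $ 2] = q"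
    by (simp_all add: vec_eq_iff forall_2)
  have test: "test_function \<Omega> (tensor (F n) (G n))" for n
    using sub by (intro test_function_tensor[OF F(1) G(1)]) (simp add: eq)
  have "(\<lambda>n. \<integral>x. v x * tensor (F n) (G n) x \<partial>lebesgue_on \<Omega>) \<longlonglongrightarrow>
      (\<integral>x. v x * indicator (box p q) x \<partial>lebesgue_on \<Omega>)"
  proof (rule integral_dominated_convergence[where w = "\<lambda>x. norm (v x)"])
    show "integrable (lebesgue_on \<Omega>) (\<lambda>x. norm (v x))" using v by simp
    have ind: "indicator (box p q) x = indicator {p $ 1<..<q $ 1} (x $ 1) * (indicator {p $ 2<..<q $ 2} (x $ 2) :: real)" for x :: "real^2"
      by (auto simp: indicator_def mem_box_cart forall_2)
    show "AE x in lebesgue_on \<Omega>. (\<lambda>n. v x * tensor (F n) (G n) x) \<longlonglongrightarrow> v x * indicator (box p q) x"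
      unfolding tensor_def ind by (intro AE_I2 tendsto_mult tendsto_const F(5) G(5))
    show "AE x in lebesgue_on \<Omega>. norm (v x * tensor (F n) (G n) x) \<le> norm (v x)" for n
    proof (intro AE_I2)
      fix x :: "real^2"
      have "\<bar>F n (x $ 1)\<bar> \<le> 1" "\<bar>G n (x $ 2)\<bar> \<le> 1"
        using F(2,3)[of n "x $ 1"] G(2,3)[of n "x $ 2"] by simp_all
      then have "\<bar>tensor (F n) (G n) x\<bar> \<le> 1"
        unfolding tensor_def abs_mult by (intro mult_le_one) auto
      then show "norm (v x * tensor (F n) (G n) x) \<le> norm (v x)"
        by (simp add: abs_mult mult_left_le)
    qed
    show "(\<lambda>x. v x * indicator (box p q) x) \<in> borel_measurable (lebesgue_on \<Omega>)"
      using v box \<Omega> by (intro borel_measurable_times borel_measurable_indicator) (auto simp: sets_restrict_space_iff)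
    show "(\<lambda>x. v x * tensor (F n) (G n) x) \<in> borel_measurable (lebesgue_on \<Omega>)" for n
      using integrable_mult_test_function[OF \<Omega> test v] by blast
  qed
  moreover have "(\<integral>x. v x * tensor (F n) (G n) x \<partial>lebesgue_on \<Omega>) = 0" for n
    using 0[OF F(1)[of n] G(1)[of n]] by (simp add: fun_distr_def)
  ultimately have *: "(\<integral>x. v x * indicator (box p q) x \<partial>lebesgue_on \<Omega>) = 0"
    by (simp add: LIMSEQ_const_iff)
  have "\<Omega> \<inter> box p q = box p q" using box by blast
  have "(\<integral>x. v x * indicator (box p q) x \<partial>lebesgue_on \<Omega>) =
      (\<integral>x. (if x \<in> box p q then v x else 0) \<partial>lebesgue_on \<Omega>)"
    by (rule Bochner_Integration.integral_cong) auto
  also have "\<dots> = (\<integral>x. v x \<partial>lebesgue_on (box p q \<inter> \<Omega>))"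
    by (rule Lebesgue_Measure.integral_restrict_Int) (use \<Omega> in auto)
  also have "\<dots> = (\<integral>x. v x \<partial>lebesgue_on (box p q))"
    using \<open>\<Omega> \<inter> box p q = box p q\<close> by (simp add: Int_commute)
  also have "\<dots> = integral (box p q) v"
  proof (rule lebesgue_integral_eq_integral)
    have "integrable lebesgue (\<lambda>x. if x \<in> \<Omega> then v x else 0)"
      using v \<Omega> by (simp add: Lebesgue_Measure.integrable_restrict_UNIV)
    then have "integrable lebesgue (\<lambda>x. indicator (box p q) x *\<^sub>R (if x \<in> \<Omega> then v x else 0))"
      by (intro integrable_mult_indicator) auto
    moreover have "(\<lambda>x. indicator (box p q) x *\<^sub>R (if x \<in> \<Omega> then v x else 0)) = (\<lambda>x. if x \<in> box p q then v x else 0)"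
      using box by (intro ext) (auto split: split_indicator)
    ultimately show "integrable (lebesgue_on (box p q)) v"
      by (simp add: Lebesgue_Measure.integrable_restrict_UNIV)
  qed auto
  also have "\<dots> = integral (cbox p q) v" by (rule integral_open_interval)
  finally show ?thesis using * by simp
qed

lemma One_nth: "(One :: real^'n) $ i = 1"
proof -
  have "(\<Sum>b\<in>Basis. 1 *\<^sub>R b) \<bullet> (axis i 1 :: real^'n) = 1"
    by (rule inner_sum_left_Basis) (simp add: axis_in_Basis_iff)
  then show ?thesis by (simp only: cart_eq_inner_axis scaleR_one)
qed

text \<open>By Lebesgue differentiation along shrinking cubes with corner \<open>x\<close>; these lie in the
  box once they are small enough, where all integrals are 0.\<close>

lemma fundamental_lemma_box:
  assumes \<Omega>: "open \<Omega>" and v: "integrable (lebesgue_on \<Omega>) v"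
    and sub: "cbox p q \<subseteq> \<Omega>"
    and 0: "\<And>f g. f \<in> bumps (p $ 1) (q $ 1) \<Longrightarrow> g \<in> bumps (p $ 2) (q $ 2) \<Longrightarrow>
      fun_distr \<Omega> v (tensor f g) = 0"
  shows "\<exists>N. negligible N \<and> (\<forall>x\<in>box p q - N. v x = 0)"
proof -
  define w where "w x = (if x \<in> \<Omega> then v x else 0)" for x
  have "integrable lebesgue w"
    using v \<Omega> unfolding w_def[abs_def] by (simp add: Lebesgue_Measure.integrable_restrict_UNIV)
  then have "w integrable_on UNIV" by (rule integrable_on_lebesgue)
  then have "w integrable_on cbox s t" for s t by (rule integrable_on_subcbox) auto
  from integrable_ccontinuous_explicit[of w, OF this] obtain N where N: "negligible N"
    and diff: "\<And>x e. x \<notin> N \<Longrightarrow> 0 < e \<Longrightarrow> \<exists>d>0. \<forall>h. 0 < h \<and> h < d \<longrightarrow>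
      norm (integral (cbox x (x + h *\<^sub>R One)) w /\<^sub>R h ^ DIM(real^2) - w x) < e" by metis
  have "v x = 0" if x: "x \<in> box p q" "x \<notin> N" for x
  proof -
    have "norm (w x) \<le> 0"
    proof (rule field_le_epsilon)
      fix e :: real assume "e > 0"
      then obtain \<delta> where \<delta>: "\<delta> > 0" "\<And>h. 0 < h \<Longrightarrow> h < \<delta> \<Longrightarrow>
          norm (integral (cbox x (x + h *\<^sub>R One)) w /\<^sub>R h ^ DIM(real^2) - w x) < e"
        using diff[OF x(2)] by meson
      \<comment> \<open>a side length below \<open>\<delta>\<close> for which the cube still fits into the box\<close>
      define h where "h = min (\<delta> / 2) (min (q $ 1 - x $ 1) (q $ 2 - x $ 2))"
      define y where "y = x + h *\<^sub>R One"
      have xy: "p $ 1 < x $ 1" "p $ 2 < x $ 2" "x $ 1 < q $ 1" "x $ 2 < q $ 2"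
        using x(1) by (auto simp: mem_box_cart forall_2)
      then have h: "h > 0" "h < \<delta>" using \<delta>(1) by (auto simp: h_def)
      have y: "y $ 1 = x $ 1 + h" "y $ 2 = x $ 2 + h"
        by (simp_all only: y_def One_nth vector_add_component vector_scaleR_component real_scaleR_def mult_1_right)
      have "h \<le> q $ 1 - x $ 1" "h \<le> q $ 2 - x $ 2" by (simp_all add: h_def)
      then have sub': "cbox x y \<subseteq> \<Omega>"
        using xy y by (intro order_trans[OF _ sub]) (auto simp: subset_iff mem_box_cart forall_2)
      have "bumps (x $ 1) (y $ 1) \<subseteq> bumps (p $ 1) (q $ 1)" "bumps (x $ 2) (y $ 2) \<subseteq> bumps (p $ 2) (q $ 2)"
        by (rule bumps_mono; use xy y \<open>h \<le> q $ 1 - x $ 1\<close> \<open>h \<le> q $ 2 - x $ 2\<close> in simp)+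
      then have "integral (cbox x y) v = 0"
        using h y by (intro integral_subbox_eq_0[OF \<Omega> v sub'] 0) auto
      moreover have "integral (cbox x y) v = integral (cbox x y) w"
        by (rule Henstock_Kurzweil_Integration.integral_cong) (use sub' in \<open>auto simp: w_def\<close>)
      ultimately show "norm (w x) \<le> 0 + e"
        using \<delta>(2)[OF h] by (simp add: y_def)
    qed
    then show "v x = 0" using x(1) sub box_subset_cbox[of p q] by (auto simp: w_def split: if_splits)
  qed
  with N show ?thesis by blast
qed

text \<open>If the polynomial vanishes on an open set then so do its directional derivatives, which are
  polynomials with fewer coefficients.\<close>

lemma quadratic_eq_0_on_open:
  assumes U: "open U" "U \<noteq> {}" and 0: "\<And>x. x \<in> U \<Longrightarrow> quadratic A B C a b c x = 0"
  shows "A = 0 \<and> B = 0 \<and> C = 0 \<and> a = 0 \<and> b = 0 \<and> c = 0"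
proof -
  have step: "quadratic 0 0 0 A B a x = 0 \<and> quadratic 0 0 0 B C b x = 0"
    if 0: "\<And>x. x \<in> U \<Longrightarrow> quadratic A B C a b c x = 0" and x: "x \<in> U" for A B C a b c x
  proof -
    have "D = 0"
      if D: "((\<lambda>t. quadratic A B C a b c (x + t *\<^sub>R e)) has_field_derivative D) (at 0)" for D e
    proof -
      have "open ((\<lambda>t. x + t *\<^sub>R e) -` U)"
        using U(1) by (intro open_vimage continuous_intros)
      then have "((\<lambda>t. 0) has_field_derivative D) (at 0)"
        using has_field_derivative_transform_within_open[OF D, of "(\<lambda>t. x + t *\<^sub>R e) -` U" "\<lambda>_. 0"] 0 x by auto
      then show "D = 0" using DERIV_unique[of "\<lambda>t. 0" D 0 0] by auto
    qed
    from this[OF quadratic_line_derivative(1)] this[OF quadratic_line_derivative(2)] show ?thesis by simp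
  qed
  obtain x where x: "x \<in> U" using U(2) by blast
  have "A = 0" "B = 0"
    using step[of 0 0 0 A B a x] step[of A B C a b c] 0 x by (simp_all add: quadratic_def)
  moreover have "C = 0"
    using step[of 0 0 0 B C b x] step[of A B C a b c] 0 x by (simp_all add: quadratic_def)
  moreover have "a = 0" "b = 0"
    using step[of A B C a b c x] 0 x calculation by (simp_all add: quadratic_def)
  moreover have "c = 0" using 0[OF x] calculation by (simp add: quadratic_def)
  ultimately show ?thesis by simp
qed

lemma quadratic_diff:
  "quadratic A B C a b c x - quadratic A' B' C' a' b' c' x =
   quadratic (A - A') (B - B') (C - C') (a - a') (b - b') (c - c') x"
  by (simp add: quadratic_def field_simps)

text \<open>On overlapping neighbourhoods two local polynomials agree almost everywhere, hence, by
  continuity, on the whole overlap, hence in all coefficients. So the map that sends a point to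
  the coefficients near it is locally constant. The relation \<open>R\<close> carries the equations for the
  second derivatives along; \<open>R 0 0 0\<close> is there for the empty set.\<close>

lemma locally_quadratic_imp_quadratic:
  assumes \<Omega>: "open \<Omega>" "connected \<Omega>"
    and loc: "\<And>x. x \<in> \<Omega> \<Longrightarrow> \<exists>U N A B C a b c. open U \<and> x \<in> U \<and> negligible N \<and> R A B C \<and>
      (\<forall>y\<in>U - N. u y = quadratic A B C a b c y)"
    and "R 0 0 0"
  shows "\<exists>A B C a b c. R A B C \<and> (AE x in lebesgue_on \<Omega>. u x = quadratic A B C a b c x)"
proof -
  define Q where "Q = (\<lambda>(A, B, C, a, b, c). quadratic A B C a b c)"
  define Rq where "Rq = (\<lambda>(A, B, C, a::real, b::real, c::real). R A B C)"
  have "\<forall>x\<in>\<Omega>. \<exists>\<kappa> U N. open U \<and> x \<in> U \<and> negligible N \<and> Rq \<kappa> \<and> (\<forall>y\<in>U - N. u y = Q \<kappa> y)"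
  proof
    fix x assume "x \<in> \<Omega>"
    from loc[OF this] obtain U N A B C a b c where "open U" "x \<in> U" "negligible N" "R A B C"
      "\<forall>y\<in>U - N. u y = quadratic A B C a b c y" by blast
    then show "\<exists>\<kappa> U N. open U \<and> x \<in> U \<and> negligible N \<and> Rq \<kappa> \<and> (\<forall>y\<in>U - N. u y = Q \<kappa> y)"
      by (intro exI[of _ "(A, B, C, a, b, c)"] exI[of _ U] exI[of _ N]) (auto simp: Q_def Rq_def)
  qed
  then obtain \<kappa> U N where *: "\<And>x. x \<in> \<Omega> \<Longrightarrow> open (U x) \<and> x \<in> U x \<and> negligible (N x) \<and> Rq (\<kappa> x) \<and>
      (\<forall>y\<in>U x - N x. u y = Q (\<kappa> x) y)" by metis
  have same: "\<kappa> x = \<kappa> y" if x: "x \<in> \<Omega>" and y: "y \<in> \<Omega>" and meet: "U x \<inter> U y \<noteq> {}" for x y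
  proof -
    obtain A B C a b c where k: "\<kappa> x = (A, B, C, a, b, c)" by (metis prod_cases6)
    obtain A' B' C' a' b' c' where l: "\<kappa> y = (A', B', C', a', b', c')" by (metis prod_cases6)
    let ?q = "quadratic (A - A') (B - B') (C - C') (a - a') (b - b') (c - c')"
    \<comment> \<open>open because polynomials are continuous, and negligible, so empty\<close>
    define V where "V = U x \<inter> U y \<inter> {z. ?q z \<noteq> 0}"
    have "open {z. ?q z \<noteq> 0}"
      by (intro open_Collect_neq continuous_on_quadratic continuous_on_const)
    then have "open V" using *[OF x] *[OF y] by (auto simp: V_def)
    have "V \<subseteq> N x \<union> N y"
    proof
      fix z assume z: "z \<in> V"
      then have "Q (\<kappa> x) z \<noteq> Q (\<kappa> y) z"
        by (simp add: V_def k l Q_def quadratic_diff[symmetric])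
      then show "z \<in> N x \<union> N y"
        using *[OF x] *[OF y] z by (metis DiffI Int_iff UnI1 UnI2 V_def)
    qed
    then have "negligible V" using *[OF x] *[OF y] negligible_subset negligible_Un by metis
    with \<open>open V\<close> have "V = {}" using open_not_negligible by blast
    then have "\<And>z. z \<in> U x \<inter> U y \<Longrightarrow> ?q z = 0" by (auto simp: V_def)
    from quadratic_eq_0_on_open[OF _ meet this] show ?thesis
      using *[OF x] *[OF y] k l by auto
  qed
  have "\<kappa> constant_on \<Omega>"
  proof (rule locally_constant_imp_constant[OF \<Omega>(2)])
    fix x assume x: "x \<in> \<Omega>"
    show "\<exists>T. openin (top_of_set \<Omega>) T \<and> x \<in> T \<and> (\<forall>y\<in>T. \<kappa> y = \<kappa> x)"
    proof (intro exI[of _ "\<Omega> \<inter> U x"] conjI ballI)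
      show "openin (top_of_set \<Omega>) (\<Omega> \<inter> U x)" using *[OF x] by (auto intro: openin_open_Int)
      show "x \<in> \<Omega> \<inter> U x" using *[OF x] x by auto
      show "\<kappa> y = \<kappa> x" if "y \<in> \<Omega> \<inter> U x" for y
        using that *[of y] x by (intro same) auto
    qed
  qed
  then obtain k where k: "\<And>x. x \<in> \<Omega> \<Longrightarrow> \<kappa> x = k" unfolding constant_on_def by blast
  obtain A B C a b c where kk: "k = (A, B, C, a, b, c)" by (metis prod_cases6)
  show ?thesis
  proof (cases "\<Omega> = {}")
    case True
    then show ?thesis using \<open>R 0 0 0\<close> by (intro exI[of _ 0]) (auto simp: space_restrict_space intro!: AE_I2)
  next
    case False
    then obtain x0 where x0: "x0 \<in> \<Omega>" by blast
    have "R A B C" using *[OF x0] k[OF x0] kk by (auto simp: Rq_def)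
    moreover have "negligible {x\<in>\<Omega>. u x \<noteq> quadratic A B C a b c x}" (is "negligible ?Z")
      unfolding locally_negligible_alt[of ?Z]
    proof
      fix x assume "x \<in> ?Z"
      then have x: "x \<in> \<Omega>" by auto
      have "?Z \<inter> U x \<subseteq> N x" using *[OF x] k[OF x] kk by (auto simp: Q_def)
      then have "negligible (?Z \<inter> U x)" using *[OF x] negligible_subset by blast
      moreover have "openin (top_of_set ?Z) (?Z \<inter> U x)" using *[OF x] by (auto intro: openin_open_Int)
      ultimately show "\<exists>V. openin (top_of_set ?Z) V \<and> x \<in> V \<and> negligible V"
        using \<open>x \<in> ?Z\<close> *[OF x] by blast
    qed
    then have "AE x in lebesgue_on \<Omega>. u x = quadratic A B C a b c x"
      using \<Omega>(1) by (simp add: AE_restrict_space_iff eventually_ae_filter_negligible)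
         (rule exI, rule conjI, assumption, auto)
    ultimately show ?thesis by blast
  qed
qed

section \<open>Functions with vanishing regulariser are quadratic\<close>

lemma signed_integral_zero: "signed_integral \<Omega> \<nu> (\<lambda>x. 0) = 0"
  by (simp add: signed_integral_def)

lemma signed_integral_cmult: "signed_integral \<Omega> \<nu> (\<lambda>x. k * f x) = k * signed_integral \<Omega> \<nu> f"
  by (simp add: signed_integral_def right_diff_distrib)

lemma measure_norm_nonneg: "0 \<le> measure_norm \<Omega> (\<mu> :: (real^2) set \<Rightarrow> real^'d)"
proof -
  have "(\<lambda>x. 0) \<in> {\<phi> \<in> C0 \<Omega>. \<forall>x\<in>\<Omega>. norm (\<phi> x :: real^'d) \<le> 1}"
    by (auto simp: C0_def)
  from SUP_upper[OF this, of "\<lambda>\<phi>. ereal (\<Sum>i\<in>UNIV. signed_integral \<Omega> (\<lambda>A. \<mu> A $ i) (\<lambda>x. \<phi> x $ i))"]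
  show ?thesis unfolding measure_norm_def by (simp add: signed_integral_zero zero_ereal_def)
qed

lemma distr_norm_nonneg: "0 \<le> distr_norm \<Omega> T"
  unfolding distr_norm_def by (intro INF_greatest measure_norm_nonneg)

lemma norm_axis: "norm (axis i c :: real^'n) = \<bar>c\<bar>"
proof -
  have "axis i c = c *\<^sub>R (axis i 1 :: real^'n)" by (simp add: vec_eq_iff axis_def)
  then show ?thesis by (simp only: norm_scaleR norm_axis_1)
qed

lemma axis_test_function_in_C0:
  assumes \<phi>: "test_function \<Omega> \<phi>"
  shows "(\<lambda>x. axis i (k * \<phi> x)) \<in> C0 \<Omega>"
proof -
  define K where "K = closure {x. \<phi> x \<noteq> 0}"
  have K: "compact K" "K \<subseteq> \<Omega>" using \<phi> by (auto simp: test_function_def K_def)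
  have K0: "\<phi> x = 0" if "x \<notin> K" for x
    using that zero_outside_closure_support by (auto simp: K_def)
  have cont: "continuous_on S \<phi>" for S by (rule test_function_continuous[OF \<phi>])
  have "compact {x \<in> \<Omega>. e \<le> norm (axis i (k * \<phi> x))}" if "e > 0" for e :: real
  proof -
    have "{x \<in> \<Omega>. e \<le> norm (axis i (k * \<phi> x))} = K \<inter> {x. e \<le> \<bar>k * \<phi> x\<bar>}"
    proof (intro set_eqI iffI)
      fix x assume "x \<in> {x \<in> \<Omega>. e \<le> norm (axis i (k * \<phi> x))}"
      then have e: "e \<le> \<bar>k * \<phi> x\<bar>" by (simp add: norm_axis)
      then have "x \<in> K" using K0[of x] that by (cases "x \<in> K") auto
      with e show "x \<in> K \<inter> {x. e \<le> \<bar>k * \<phi> x\<bar>}" by simp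
    qed (use K(2) in \<open>auto simp: norm_axis\<close>)
    moreover have "closed {x. e \<le> \<bar>k * \<phi> x\<bar>}"
      using cont by (intro closed_Collect_le continuous_intros)
    ultimately show ?thesis using K(1) by (simp add: compact_Int_closed)
  qed
  moreover have "continuous_on \<Omega> (\<lambda>x. axis i (k * \<phi> x))"
    unfolding axis_def
  proof (rule continuous_on_vec_lambda)
    show "continuous_on \<Omega> (\<lambda>x. if l = i then k * \<phi> x else 0)" for l
      by (cases "l = i") (auto intro!: continuous_on_mult cont continuous_on_const)
  qed
  ultimately show ?thesis by (simp add: C0_def)
qed

text \<open>The test function, scaled to sup norm at most 1 with either sign and placed in one component,
  competes in the supremum that defines the norm.\<close>

lemma measure_distr_le_measure_norm:
  assumes \<phi>: "test_function \<Omega> \<phi>" and M: "M > 0" "\<And>x. \<bar>\<phi> x\<bar> \<le> M"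
    and r: "measure_norm \<Omega> \<mu> \<le> ereal r"
  shows "\<bar>measure_distr \<Omega> \<mu> \<phi> $ i\<bar> \<le> M * r"
proof -
  let ?I = "signed_integral \<Omega> (\<lambda>A. \<mu> A $ i) \<phi>"
  have *: "k * ?I \<le> r" if k: "\<bar>k\<bar> = 1 / M" for k
  proof -
    have "norm (axis i (k * \<phi> x)) \<le> 1" for x
      using M(1) M(2)[of x] k by (simp add: norm_axis abs_mult)
    then have mem: "(\<lambda>x. axis i (k * \<phi> x)) \<in> {\<phi> \<in> C0 \<Omega>. \<forall>x\<in>\<Omega>. norm (\<phi> x) \<le> 1}"
      using axis_test_function_in_C0[OF \<phi>] by blast
    have "signed_integral \<Omega> (\<lambda>A. \<mu> A $ j) (\<lambda>x. axis i (k * \<phi> x) $ j) = (if j = i then k * ?I else 0)" for j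
      by (simp add: axis_def signed_integral_zero signed_integral_cmult)
    then have "ereal (k * ?I) \<le> measure_norm \<Omega> \<mu>"
      using SUP_upper[OF mem, of "\<lambda>\<phi>. ereal (\<Sum>j\<in>UNIV. signed_integral \<Omega> (\<lambda>A. \<mu> A $ j) (\<lambda>x. \<phi> x $ j))"]
      unfolding measure_norm_def by simp
    with r have "ereal (k * ?I) \<le> ereal r" by (rule order_trans[rotated])
    then show ?thesis by simp
  qed
  have "?I \<le> M * r" "- ?I \<le> M * r"
    using *[of "1 / M"] *[of "- (1 / M)"] M(1) by (auto simp: field_simps)
  then show ?thesis by (auto simp: measure_distr_def)
qed

lemma distr_norm_bound:
  assumes \<phi>: "test_function \<Omega> \<phi>" and M: "M > 0" "\<And>x. \<bar>\<phi> x\<bar> \<le> M"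
    and "distr_norm \<Omega> T < ereal r"
  shows "\<bar>T \<phi> $ i\<bar> \<le> M * r"
proof -
  from assms(4) obtain \<mu> where "T \<phi> = measure_distr \<Omega> \<mu> \<phi>" "measure_norm \<Omega> \<mu> < ereal r"
    unfolding distr_norm_def INF_less_iff using \<phi> by blast
  then show ?thesis using measure_distr_le_measure_norm[OF \<phi> M] less_imp_le by metis
qed

lemma test_function_bounded:
  assumes "test_function \<Omega> \<phi>"
  obtains M where "M > 0" "\<And>x. \<bar>\<phi> x\<bar> \<le> M"
proof (rule compactly_supported_bounded[of \<phi> "closure {x. \<phi> x \<noteq> 0}"])
  show "\<phi> x = 0" if "x \<notin> closure {x. \<phi> x \<noteq> 0}" for x
    using that by (rule zero_outside_closure_support)
qed (use assms test_function_continuous[OF assms] that in \<open>auto simp: test_function_def\<close>)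

lemma vector_4:
  "(vector [w, x, y, z] :: ('a::zero)^4) $ 1 = w"
  "(vector [w, x, y, z] :: ('a::zero)^4) $ 2 = x"
  "(vector [w, x, y, z] :: ('a::zero)^4) $ 3 = y"
  "(vector [w, x, y, z] :: ('a::zero)^4) $ 4 = z"
  unfolding vector_def by simp_all

lemma nabla_N_nth:
  "nabla_N W \<phi> $ 1 = - (W (pderiv_at 1 \<phi>) $ 2) + W (pderiv_at 2 \<phi>) $ 1"
  "nabla_N W \<phi> $ 2 = - (W (pderiv_at 1 \<phi>) $ 1) - W (pderiv_at 2 \<phi>) $ 2"
  "nabla_N W \<phi> $ 3 = - (W (pderiv_at 2 \<phi>) $ 2) + W (pderiv_at 1 \<phi>) $ 1"
  "nabla_N W \<phi> $ 4 = - (W (pderiv_at 2 \<phi>) $ 1) - W (pderiv_at 1 \<phi>) $ 2"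
  by (simp_all add: nabla_N_def vector_4 curl_def divg_def sh1_def sh2_def distr_pderiv_def dcomp_def)

text \<open>For a measure \<open>w\<close> with value below \<open>e\<close> in the infimum, both the distance of the gradient from
  \<open>w\<close>, tested with the derivatives of \<open>\<phi>\<close>, and the weighted \<open>nabla_N w\<close>, tested with \<open>\<phi>\<close>, are
  at most a constant times \<open>e\<close>. The constant depends on \<open>\<phi>\<close> and \<open>\<beta>\<close> but not on \<open>w\<close>, so no compactness of the
  measures is needed.\<close>

lemma R_reg_eq_0_imp_weighted_second_derivatives:
  assumes 0: "R_reg \<Omega> \<beta> u = 0" and \<phi>: "test_function \<Omega> \<phi>"
  shows "\<beta> $ j * nabla_N (grad (fun_distr \<Omega> u)) \<phi> $ j = 0"
proof -
  let ?G = "grad (fun_distr \<Omega> u)"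
  note \<phi>1 = test_function_pderiv_at[OF \<phi>, of 1] and \<phi>2 = test_function_pderiv_at[OF \<phi>, of 2]
  obtain M0 M1 M2 where M: "M0 > 0" "M1 > 0" "M2 > 0" "\<And>x. \<bar>\<phi> x\<bar> \<le> M0"
      "\<And>x. \<bar>pderiv_at 1 \<phi> x\<bar> \<le> M1" "\<And>x. \<bar>pderiv_at 2 \<phi> x\<bar> \<le> M2"
    using test_function_bounded[OF \<phi>] test_function_bounded[OF \<phi>1] test_function_bounded[OF \<phi>2] by metis
  define c where "c = M0 + \<bar>\<beta> $ j\<bar> * (M1 + M2)"
  have c: "c > 0" using M by (auto simp: c_def intro!: add_pos_nonneg)
  have bound: "\<bar>\<beta> $ j * nabla_N ?G \<phi> $ j\<bar> \<le> c * e" if "e > 0" for e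
  proof -
    have "R_reg \<Omega> \<beta> u < ereal e" using 0 that by simp
    then obtain w where w: "distr_norm \<Omega> (\<lambda>\<phi>. ?G \<phi> - measure_distr \<Omega> w \<phi>) +
        distr_norm \<Omega> (diag_mult \<beta> (nabla_N (measure_distr \<Omega> w))) < ereal e"
      unfolding R_reg_def INF_less_iff by blast
    let ?W = "measure_distr \<Omega> w"
    have 1: "distr_norm \<Omega> (\<lambda>\<phi>. ?G \<phi> - ?W \<phi>) < ereal e"
      by (rule le_less_trans[OF _ w]) (simp add: distr_norm_nonneg add_increasing2)
    have 2: "distr_norm \<Omega> (diag_mult \<beta> (nabla_N ?W)) < ereal e"
      by (rule le_less_trans[OF _ w]) (simp add: distr_norm_nonneg add_increasing)
    have "\<bar>(?G (pderiv_at 1 \<phi>) - ?W (pderiv_at 1 \<phi>)) $ k\<bar> \<le> M1 * e"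
      "\<bar>(?G (pderiv_at 2 \<phi>) - ?W (pderiv_at 2 \<phi>)) $ k\<bar> \<le> M2 * e" for k
      using distr_norm_bound[OF \<phi>1 M(2,5) 1] distr_norm_bound[OF \<phi>2 M(3,6) 1] by simp_all
    note b = this[of 1] this[of 2]
    have "\<bar>nabla_N ?G \<phi> $ j - nabla_N ?W \<phi> $ j\<bar> \<le> M1 * e + M2 * e"
      using exhaust_4[of j] b by (auto simp: nabla_N_nth)
    then have "\<bar>\<beta> $ j * (nabla_N ?G \<phi> $ j - nabla_N ?W \<phi> $ j)\<bar> \<le> \<bar>\<beta> $ j\<bar> * ((M1 + M2) * e)"
      unfolding abs_mult by (intro mult_left_mono) (auto simp: algebra_simps)
    moreover have "\<bar>\<beta> $ j * nabla_N ?W \<phi> $ j\<bar> \<le> M0 * e"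
      using distr_norm_bound[OF \<phi> M(1,4) 2, of j] by (simp add: diag_mult_def)
    ultimately show ?thesis by (simp add: c_def algebra_simps)
  qed
  have "\<bar>\<beta> $ j * nabla_N ?G \<phi> $ j\<bar> \<le> 0"
  proof (rule field_le_epsilon)
    fix e :: real assume "e > 0"
    then show "\<bar>\<beta> $ j * nabla_N ?G \<phi> $ j\<bar> \<le> 0 + e"
      using bound[of "e / c"] c by simp
  qed
  then show ?thesis by simp
qed

lemma nabla_N_grad_tensor:
  fixes u :: "real^2 \<Rightarrow> real" and \<Omega> :: "(real^2) set"
  assumes f: "f \<in> bumps a b" and g: "g \<in> bumps c d"
  defines "P \<equiv> (\<lambda>f g. fun_distr \<Omega> u (tensor f g))"
  shows "nabla_N (grad (fun_distr \<Omega> u)) (tensor f g) $ 2 = P (deriv (deriv f)) g + P f (deriv (deriv g))"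
    "nabla_N (grad (fun_distr \<Omega> u)) (tensor f g) $ 3 = P f (deriv (deriv g)) - P (deriv (deriv f)) g"
    "nabla_N (grad (fun_distr \<Omega> u)) (tensor f g) $ 4 = 2 * P (deriv f) (deriv g)"
  using f g deriv_in_bumps[OF f] deriv_in_bumps[OF g]
  by (simp_all add: nabla_N_nth grad_def distr_pderiv_def P_def
      pderiv_at_tensor[OF f g] pderiv_at_tensor[OF deriv_in_bumps[OF f] g] pderiv_at_tensor[OF f deriv_in_bumps[OF g]])

lemma L2_imp_integrable:
  assumes "open \<Omega>" "bounded \<Omega>" "u \<in> L2 \<Omega>"
  shows "integrable (lebesgue_on \<Omega>) u"
proof (rule Bochner_Integration.integrable_bound)
  have "integrable (lebesgue_on \<Omega>) (quadratic 0 0 0 0 0 1)" by (rule integrable_quadratic[OF assms(1,2)])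
  then show "integrable (lebesgue_on \<Omega>) (\<lambda>x. 1 + (u x)\<^sup>2)"
    using assms(3) by (simp add: quadratic_def[abs_def] L2_def)
  show "u \<in> borel_measurable (lebesgue_on \<Omega>)" using assms(3) by (simp add: L2_def)
  have "\<bar>t\<bar> \<le> 1 + t\<^sup>2" for t :: real
    using zero_le_power2[of "\<bar>t\<bar> - 1"] zero_le_power2[of t] by (simp add: power2_diff)
  then show "AE x in lebesgue_on \<Omega>. norm (u x) \<le> norm (1 + (u x)\<^sup>2)"
    by (intro AE_I2) (simp add: order_trans[OF _ abs_ge_self])
qed

text \<open>Two of the equations suffice for the third derivatives: if the mixed derivative vanishes and
  the two pure second derivatives agree up to sign, a further derivative turns each pure one
  into a mixed one; and if both combinations of the pure ones vanish, these vanish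
  themselves.\<close>

lemma quadratic_on_box:
  assumes \<Omega>: "open \<Omega>" "bounded \<Omega>" and u: "integrable (lebesgue_on \<Omega>) u"
    and sub: "cbox p q \<subseteq> \<Omega>" and pq: "p $ 1 < q $ 1" "p $ 2 < q $ 2"
    and eqs: "\<And>\<phi> j. test_function \<Omega> \<phi> \<Longrightarrow> \<beta> $ j * nabla_N (grad (fun_distr \<Omega> u)) \<phi> $ j = 0"
    and two: "\<beta> $ 3 \<noteq> 0 \<and> \<beta> $ 4 \<noteq> 0 \<or> \<beta> $ 2 \<noteq> 0 \<and> \<beta> $ 4 \<noteq> 0 \<or> \<beta> $ 2 \<noteq> 0 \<and> \<beta> $ 3 \<noteq> 0"
  shows "\<exists>N A B C a b c. negligible N \<and>
    (\<beta> $ 2 * (A + C) = 0 \<and> \<beta> $ 3 * (C - A) = 0 \<and> \<beta> $ 4 * B = 0) \<and>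
    (\<forall>y\<in>box p q - N. u y = quadratic A B C a b c y)"
proof -
  define P where "P = (\<lambda>f g. fun_distr \<Omega> u (tensor f g))"
  let ?D1 = "bumps (p $ 1) (q $ 1)" and ?D2 = "bumps (p $ 2) (q $ 2)"
  have sub': "cbox (vector [p $ 1, p $ 2]) (vector [q $ 1, q $ 2]) \<subseteq> \<Omega>"
  proof -
    have "vector [p $ 1, p $ 2] = p" "vector [q $ 1, q $ 2] = q"
      by (simp_all add: vec_eq_iff forall_2)
    with sub show ?thesis by simp
  qed
  note d = deriv_in_bumps
  have eq: "\<beta> $ 2 * (P (deriv (deriv f)) g + P f (deriv (deriv g))) = 0"
    "\<beta> $ 3 * (P f (deriv (deriv g)) - P (deriv (deriv f)) g) = 0"
    "\<beta> $ 4 * P (deriv f) (deriv g) = 0" if "f \<in> ?D1" "g \<in> ?D2" for f g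
    using eqs[OF test_function_tensor[OF that sub'], of 2] eqs[OF test_function_tensor[OF that sub'], of 3]
      eqs[OF test_function_tensor[OF that sub'], of 4]
    unfolding nabla_N_grad_tensor[OF that] P_def by simp_all
  \<comment> \<open>each equation is differentiated once: it is used for \<open>(f', g)\<close> and for \<open>(f, g')\<close>\<close>
  have third: "P (deriv (deriv (deriv f))) g = 0 \<and> P (deriv (deriv f)) (deriv g) = 0 \<and>
      P (deriv f) (deriv (deriv g)) = 0 \<and> P f (deriv (deriv (deriv g))) = 0"
    if f: "f \<in> ?D1" and g: "g \<in> ?D2" for f g
    using two eq[OF d[OF f] g] eq[OF f d[OF g]] by auto
  have "\<exists>A B C a b c. \<forall>f\<in>?D1. \<forall>g\<in>?D2.
      P f g = fun_distr \<Omega> (quadratic A B C a b c) (tensor f g)"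
    by (rule weakly_quadratic_on_box[OF \<Omega> u pq sub' P_def]) (rule third)
  then obtain A B C a b c where "\<forall>f\<in>?D1. \<forall>g\<in>?D2.
      P f g = fun_distr \<Omega> (quadratic A B C a b c) (tensor f g)" by (elim exE)
  then have *: "P f g = fun_distr \<Omega> (quadratic A B C a b c) (tensor f g)"
    if "f \<in> ?D1" "g \<in> ?D2" for f g
    using that by simp
  obtain \<theta> \<eta> where \<theta>: "\<theta> \<in> ?D1" and \<eta>: "\<eta> \<in> ?D2"
    and nz: "fun_distr \<Omega> (quadratic 0 0 0 0 0 1) (tensor \<theta> \<eta>) \<noteq> 0"
    using fun_distr_one_tensor_pos[OF \<Omega> pq sub'] by blast
  let ?I = "fun_distr \<Omega> (quadratic 0 0 0 0 0 1) (tensor \<theta> \<eta>)"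
  have const: "fun_distr \<Omega> (quadratic 0 0 0 0 0 k) \<phi> = k * fun_distr \<Omega> (quadratic 0 0 0 0 0 1) \<phi>" for k \<phi>
    by (simp add: fun_distr_def quadratic_def[abs_def])
  have Q: "fun_distr \<Omega> (quadratic A B C a b c) (tensor (deriv f) g) = - fun_distr \<Omega> (quadratic 0 0 0 A B a) (tensor f g)"
     "fun_distr \<Omega> (quadratic A B C a b c) (tensor f (deriv g)) = - fun_distr \<Omega> (quadratic 0 0 0 B C b) (tensor f g)"
    if "f \<in> ?D1" "g \<in> ?D2" for A B C a b c f g
    using fun_distr_quadratic_pderiv_at[OF \<Omega>(1) test_function_tensor[OF that sub'], of A B C a b c]
    by (simp_all add: pderiv_at_tensor[OF that])
  have "P (deriv (deriv \<theta>)) \<eta> = A * ?I" "P (deriv \<theta>) (deriv \<eta>) = B * ?I" "P \<theta> (deriv (deriv \<eta>)) = C * ?I"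
    using \<theta> \<eta> by (simp_all add: * d Q const[of A] const[of B] const[of C])
  then have "\<beta> $ 2 * (A + C) * ?I = 0" "\<beta> $ 3 * (C - A) * ?I = 0" "\<beta> $ 4 * B * ?I = 0"
    using eq[OF \<theta> \<eta>] by (simp_all add: algebra_simps)
  with nz have R: "\<beta> $ 2 * (A + C) = 0 \<and> \<beta> $ 3 * (C - A) = 0 \<and> \<beta> $ 4 * B = 0" by simp
  have "\<exists>N. negligible N \<and> (\<forall>x\<in>box p q - N. u x - quadratic A B C a b c x = 0)"
  proof (rule fundamental_lemma_box[OF \<Omega>(1) _ sub])
    note q = integrable_quadratic[OF \<Omega>, of A B C a b c]
    show "integrable (lebesgue_on \<Omega>) (\<lambda>x. u x - quadratic A B C a b c x)" using u q by simp
    fix f g assume fg: "f \<in> ?D1" "g \<in> ?D2"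
    note t = test_function_tensor[OF fg sub']
    show "fun_distr \<Omega> (\<lambda>x. u x - quadratic A B C a b c x) (tensor f g) = 0"
      using *[OF fg] integrable_mult_test_function[OF \<Omega>(1) t u] integrable_mult_test_function[OF \<Omega>(1) t q]
      by (simp add: P_def fun_distr_def left_diff_distrib)
  qed
  then obtain N where "negligible N" "\<forall>x\<in>box p q - N. u x = quadratic A B C a b c x"
    by (auto simp only: right_minus_eq)
  with R show ?thesis by blast
qed

lemma nullspace_imp_quadratic:
  assumes \<Omega>: "open \<Omega>" "connected \<Omega>" "bounded \<Omega>" and u: "u \<in> nullspace \<Omega> \<beta>"
    and two: "\<beta> $ 3 \<noteq> 0 \<and> \<beta> $ 4 \<noteq> 0 \<or> \<beta> $ 2 \<noteq> 0 \<and> \<beta> $ 4 \<noteq> 0 \<or> \<beta> $ 2 \<noteq> 0 \<and> \<beta> $ 3 \<noteq> 0"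
  shows "\<exists>A B C a b c. (\<beta> $ 2 * (A + C) = 0 \<and> \<beta> $ 3 * (C - A) = 0 \<and> \<beta> $ 4 * B = 0) \<and>
    (AE x in lebesgue_on \<Omega>. u x = quadratic A B C a b c x)"
proof (rule locally_quadratic_imp_quadratic[OF \<Omega>(1,2)])
  have int: "integrable (lebesgue_on \<Omega>) u"
    using L2_imp_integrable[OF \<Omega>(1,3)] u by (simp add: nullspace_def)
  have eqs: "\<beta> $ j * nabla_N (grad (fun_distr \<Omega> u)) \<phi> $ j = 0" if "test_function \<Omega> \<phi>" for \<phi> j
    using R_reg_eq_0_imp_weighted_second_derivatives[OF _ that] u by (simp add: nullspace_def)
  fix x assume "x \<in> \<Omega>"
  from open_contains_cbox[OF \<Omega>(1) this] obtain p q where pq: "cbox p q \<subseteq> \<Omega>" "x \<in> box p q" by metis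
  then have "p $ 1 < q $ 1" "p $ 2 < q $ 2"
    using pq(2) by (auto simp: mem_box_cart forall_2)
  from quadratic_on_box[OF \<Omega>(1,3) int pq(1) this eqs two] pq(2) open_box
  show "\<exists>U N A B C a b c. open U \<and> x \<in> U \<and> negligible N \<and>
      (\<beta> $ 2 * (A + C) = 0 \<and> \<beta> $ 3 * (C - A) = 0 \<and> \<beta> $ 4 * B = 0) \<and>
      (\<forall>y\<in>U - N. u y = quadratic A B C a b c y)" by blast
qed auto

section \<open>Quadratic polynomials have vanishing regulariser\<close>

lemma set_integral_sums:
  fixes f :: "'a \<Rightarrow> real" and A :: "nat \<Rightarrow> 'a set"
  assumes A: "\<And>i. A i \<in> sets M" "disjoint_family A" and f: "integrable M f"
  shows "(\<lambda>i. LINT x:A i|M. f x) sums (LINT x:(\<Union>i. A i)|M. f x)"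
proof -
  have int: "set_integrable M B f" if "B \<in> sets M" for B
    unfolding set_integrable_def by (rule integrable_mult_indicator[OF that f])
  have "(\<lambda>n. LINT x:(\<Union>i<n. A i)|M. f x) \<longlonglongrightarrow> (LINT x:(\<Union>n. \<Union>i<n. A i)|M. f x)"
  proof (rule set_integral_cont_up)
    show "incseq (\<lambda>n. \<Union>i<n. A i)" by (intro incseq_SucI UN_mono) auto
  qed (use A(1) in \<open>auto intro!: int\<close>)
  also have "(\<Union>n. \<Union>i<n. A i) = (\<Union>i. A i)" by blast
  finally show ?thesis
    unfolding sums_def
    using A int by (subst set_integral_finite_Union[symmetric])
      (auto intro: disjoint_family_on_mono[of _ UNIV])
qed

text \<open>The Hahn decomposition is explicit here: the supremum is attained at the part of \<open>A\<close> on which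
  the density is nonnegative.\<close>

lemma SUP_set_integral_eq_nn_integral:
  fixes g :: "'a \<Rightarrow> real"
  assumes g: "integrable M g" and A: "A \<in> sets M"
  shows "(SUP B\<in>{B \<in> sets M. B \<subseteq> A}. ennreal (LINT x:B|M. g x)) = (\<integral>\<^sup>+x. ennreal (g x) * indicator A x \<partial>M)"
proof (rule antisym)
  have [measurable]: "g \<in> borel_measurable M" using g by simp
  show "(SUP B\<in>{B \<in> sets M. B \<subseteq> A}. ennreal (LINT x:B|M. g x)) \<le> (\<integral>\<^sup>+x. ennreal (g x) * indicator A x \<partial>M)"
  proof (rule SUP_least)
    fix B assume B: "B \<in> {B \<in> sets M. B \<subseteq> A}"
    have int: "integrable M (\<lambda>x. indicator B x *\<^sub>R g x)" "integrable M (\<lambda>x. indicator B x *\<^sub>R max 0 (g x))"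
      by (rule integrable_mult_indicator; use B g in simp)+
    have "(LINT x:B|M. g x) \<le> (\<integral>x. indicator B x *\<^sub>R max 0 (g x) \<partial>M)"
      unfolding set_lebesgue_integral_def
      by (rule integral_mono[OF int]) (auto split: split_indicator)
    then have "ennreal (LINT x:B|M. g x) \<le> ennreal (\<integral>x. indicator B x *\<^sub>R max 0 (g x) \<partial>M)"
      by (rule ennreal_leI)
    also have "\<dots> = (\<integral>\<^sup>+x. ennreal (indicator B x *\<^sub>R max 0 (g x)) \<partial>M)"
      by (rule nn_integral_eq_integral[OF int(2), symmetric]) (auto split: split_indicator)
    also have "\<dots> \<le> (\<integral>\<^sup>+x. ennreal (g x) * indicator A x \<partial>M)"
      using B by (intro nn_integral_mono) (auto split: split_indicator simp: max_def ennreal_neg)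
    finally show "ennreal (LINT x:B|M. g x) \<le> (\<integral>\<^sup>+x. ennreal (g x) * indicator A x \<partial>M)" .
  qed
  define B where "B = {x \<in> space M. 0 \<le> g x} \<inter> A"
  have B: "B \<in> sets M" "B \<subseteq> A" using A by (auto simp: B_def)
  have "(\<integral>\<^sup>+x. ennreal (g x) * indicator A x \<partial>M) = (\<integral>\<^sup>+x. ennreal (indicator B x *\<^sub>R g x) \<partial>M)"
    by (rule nn_integral_cong) (auto simp: B_def ennreal_neg split: split_indicator)
  also have "\<dots> = ennreal (LINT x:B|M. g x)"
    unfolding set_lebesgue_integral_def
    using g B(1) by (intro nn_integral_eq_integral integrable_mult_indicator)
      (auto simp: B_def split: split_indicator)
  also have "\<dots> \<le> (SUP B\<in>{B \<in> sets M. B \<subseteq> A}. ennreal (LINT x:B|M. g x))"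
    using B by (intro SUP_upper) auto
  finally show "(\<integral>\<^sup>+x. ennreal (g x) * indicator A x \<partial>M) \<le> \<dots>" .
qed

lemma pos_variation_density:
  assumes g: "integrable (restrict_space lborel \<Omega>) g"
  shows "pos_variation \<Omega> (\<lambda>A. LINT x:A|restrict_space lborel \<Omega>. g x) =
    density (restrict_space lborel \<Omega>) (\<lambda>x. ennreal (max 0 (g x)))"
proof -
  let ?M = "restrict_space lborel \<Omega>" let ?D = "density ?M (\<lambda>x. ennreal (max 0 (g x)))"
  have sets: "sets (restrict_space borel \<Omega>) = sets ?M" by (intro sets_restrict_space_cong) simp
  have space: "space ?D = \<Omega>" by (simp add: space_restrict_space)
  have "pos_variation \<Omega> (\<lambda>A. LINT x:A|?M. g x) = measure_of \<Omega> (sets ?M)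
      (\<lambda>A. SUP B\<in>{B \<in> sets ?M. B \<subseteq> A}. ennreal (LINT x:B|?M. g x))"
    unfolding pos_variation_def sets ..
  also have "\<dots> = measure_of \<Omega> (sets ?M) (emeasure ?D)"
  proof (rule measure_of_eq)
    show "sets ?M \<subseteq> Pow \<Omega>" using sets.space_closed[of ?M] by (simp add: space_restrict_space)
    fix A assume "A \<in> sigma_sets \<Omega> (sets ?M)"
    then have A: "A \<in> sets ?M" using sets.sigma_sets_eq[of ?M] by (simp add: space_restrict_space)
    have "ennreal (max 0 (g x)) = ennreal (g x)" for x by (simp add: max_def ennreal_neg)
    then show "(SUP B\<in>{B \<in> sets ?M. B \<subseteq> A}. ennreal (LINT x:B|?M. g x)) = emeasure ?D A"
      using SUP_set_integral_eq_nn_integral[OF g A] g A by (simp add: emeasure_density)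
  qed
  also have "\<dots> = ?D"
    using measure_of_of_measure[of ?D] space by simp
  finally show ?thesis .
qed

lemma signed_integral_density:
  assumes g: "integrable (restrict_space lborel \<Omega>) g"
    and \<phi>: "\<phi> \<in> borel_measurable borel" "\<And>x. \<bar>\<phi> x\<bar> \<le> M"
  shows "signed_integral \<Omega> (\<lambda>A. LINT x:A|restrict_space lborel \<Omega>. g x) \<phi> =
    (\<integral>x. g x * \<phi> x \<partial>(restrict_space lborel \<Omega>))"
proof -
  let ?M = "restrict_space lborel \<Omega>"
  have \<phi>M [measurable]: "\<phi> \<in> borel_measurable ?M"
    by (rule measurable_restrict_space1) (use \<phi>(1) in simp)
  have [measurable]: "g \<in> borel_measurable ?M" using g by simp
  have neg: "(\<lambda>A. - (LINT x:A|?M. g x)) = (\<lambda>A. LINT x:A|?M. - g x)"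
    by (simp add: set_lebesgue_integral_def)
  have int: "integrable ?M (\<lambda>x. max 0 (h x) * \<phi> x)" if h: "integrable ?M h" for h
  proof (rule Bochner_Integration.integrable_bound)
    show "integrable ?M (\<lambda>x. M * h x)" using h by simp
    have [measurable]: "h \<in> borel_measurable ?M" using h by simp
    show "(\<lambda>x. max 0 (h x) * \<phi> x) \<in> borel_measurable ?M" by measurable
    have "\<bar>max 0 (h x)\<bar> * \<bar>\<phi> x\<bar> \<le> \<bar>h x\<bar> * \<bar>M\<bar>" for x
      using \<phi>(2)[of x] by (intro mult_mono) auto
    then show "AE x in ?M. norm (max 0 (h x) * \<phi> x) \<le> norm (M * h x)"
      by (simp add: abs_mult mult.commute)
  qed
  have "signed_integral \<Omega> (\<lambda>A. LINT x:A|?M. g x) \<phi> =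
      (\<integral>x. max 0 (g x) * \<phi> x \<partial>?M) - (\<integral>x. max 0 (- g x) * \<phi> x \<partial>?M)"
    using g unfolding signed_integral_def neg
    by (simp add: pos_variation_density integral_density)
  also have "\<dots> = (\<integral>x. max 0 (g x) * \<phi> x - max 0 (- g x) * \<phi> x \<partial>?M)"
    using int[OF g] int[of "\<lambda>x. - g x"] g by (simp add: Bochner_Integration.integral_diff)
  also have "\<dots> = (\<integral>x. g x * \<phi> x \<partial>?M)"
    by (intro Bochner_Integration.integral_cong) (auto simp: max_def)
  finally show ?thesis .
qed

definition density_measure :: "(real^2) set \<Rightarrow> (real^2 \<Rightarrow> real^2) \<Rightarrow> (real^2) set \<Rightarrow> real^2" where
  "density_measure \<Omega> G A = (\<chi> i. LINT x:A|restrict_space lborel \<Omega>. G x $ i)"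

lemma density_measure_radon:
  assumes "open \<Omega>" "bounded \<Omega>" "\<And>i. continuous_on UNIV (\<lambda>x. G x $ i)"
  shows "density_measure \<Omega> G \<in> radon_measures \<Omega>"
  unfolding radon_measures_def
proof (intro CollectI allI impI)
  fix A :: "nat \<Rightarrow> (real^2) set"
  assume A: "range A \<subseteq> sets (restrict_space borel \<Omega>)" "disjoint_family A"
  let ?M = "restrict_space lborel \<Omega>"
  have "sets (restrict_space borel \<Omega>) = sets ?M" by (intro sets_restrict_space_cong) simp
  then have "A k \<in> sets ?M" for k using A(1) by auto
  then have "(\<lambda>k. LINT x:A k|?M. G x $ i) sums (LINT x:(\<Union>k. A k)|?M. G x $ i)" for i
    using A(2) integrable_continuous_bounded_open(2)[OF assms(1,2,3)] by (intro set_integral_sums)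
  then show "(\<lambda>k. density_measure \<Omega> G (A k)) sums density_measure \<Omega> G (\<Union>k. A k)"
    unfolding sums_def by (intro vec_tendstoI) (simp add: density_measure_def sum_component)
qed

lemma measure_distr_density_measure:
  assumes "open \<Omega>" "bounded \<Omega>" "\<And>i. continuous_on UNIV (\<lambda>x. G x $ i)" and \<phi>: "test_function \<Omega> \<phi>"
  shows "measure_distr \<Omega> (density_measure \<Omega> G) \<phi> $ i = fun_distr \<Omega> (\<lambda>x. G x $ i) \<phi>"
proof -
  let ?M = "restrict_space lborel \<Omega>"
  obtain M where M: "\<And>x. \<bar>\<phi> x\<bar> \<le> M" using test_function_bounded[OF \<phi>] by metis
  have "\<phi> \<in> borel_measurable borel"
    using test_function_continuous[OF \<phi>] by (rule borel_measurable_continuous_onI)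
  then have "measure_distr \<Omega> (density_measure \<Omega> G) \<phi> $ i = (\<integral>x. G x $ i * \<phi> x \<partial>?M)"
    using signed_integral_density[OF integrable_continuous_bounded_open(2)[OF assms(1,2,3)] _ M]
    by (simp add: measure_distr_def density_measure_def)
  also have "\<dots> = (\<integral>x. indicator \<Omega> x *\<^sub>R (G x $ i * \<phi> x) \<partial>lborel)"
    using assms(1) by (intro integral_restrict_space) auto
  also have "(\<lambda>x. indicator \<Omega> x *\<^sub>R (G x $ i * \<phi> x)) = (\<lambda>x. G x $ i * \<phi> x)"
    using test_function_outside[OF \<phi>] by (intro ext) (simp split: split_indicator)
  finally show ?thesis
    using fun_distr_continuous[OF assms(1) \<phi> assms(3)] by simp
qed

text \<open>The zero measure represents \<open>T\<close>, and the norm is an infimum over representing measures.\<close>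

lemma distr_norm_eq_0:
  assumes "\<And>\<phi>. test_function \<Omega> \<phi> \<Longrightarrow> T \<phi> = (0 :: real^'d)"
  shows "distr_norm \<Omega> T = 0"
proof (rule antisym)
  let ?z = "\<lambda>A. 0 :: real^'d"
  have s: "signed_integral \<Omega> (\<lambda>A. 0) f = 0" for f by (simp add: signed_integral_def)
  have "?z \<in> {\<mu> \<in> radon_measures \<Omega>. \<forall>\<phi>. test_function \<Omega> \<phi> \<longrightarrow> T \<phi> = measure_distr \<Omega> \<mu> \<phi>}"
    using assms by (simp add: radon_measures_def measure_distr_def s vec_eq_iff)
  from INF_lower[OF this, of "measure_norm \<Omega>"]
  have "distr_norm \<Omega> T \<le> measure_norm \<Omega> ?z" by (simp add: distr_norm_def)
  also have "\<dots> \<le> 0" unfolding measure_norm_def by (rule SUP_least) (simp add: s zero_ereal_def)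
  finally show "distr_norm \<Omega> T \<le> 0" .
qed (rule distr_norm_nonneg)

lemma R_reg_nonneg: "0 \<le> R_reg \<Omega> \<beta> u"
  unfolding R_reg_def by (intro INF_greatest add_nonneg_nonneg distr_norm_nonneg)

lemma AE_continuous_imp_L2:
  assumes "open \<Omega>" "bounded \<Omega>" "continuous_on UNIV v" and ae: "AE x in lebesgue_on \<Omega>. u x = v x"
  shows "u \<in> L2 \<Omega>"
proof -
  have \<Omega>: "\<Omega> \<in> sets lebesgue" using assms(1) by auto
  have v: "v \<in> borel_measurable (lebesgue_on \<Omega>)"
    using integrable_continuous_bounded_open(1)[OF assms(1-3)] by simp
  have "AE x in lebesgue. x \<in> \<Omega> \<longrightarrow> u x = v x"
    using ae \<Omega> by (simp add: AE_restrict_space_iff)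
  then have "AE x in lebesgue. (if x \<in> \<Omega> then v x else 0) = (if x \<in> \<Omega> then u x else 0)"
    by eventually_elim auto
  then have u: "u \<in> borel_measurable (lebesgue_on \<Omega>)"
    using borel_measurable_AE[of "\<lambda>x. if x \<in> \<Omega> then v x else 0" "\<lambda>x. if x \<in> \<Omega> then u x else 0"] v
    by (simp add: borel_measurable_if[OF \<Omega>])
  have "continuous_on UNIV (\<lambda>x. (v x)\<^sup>2)" using assms(3) by (intro continuous_intros)
  from integrable_continuous_bounded_open(1)[OF assms(1,2) this]
  have "integrable (lebesgue_on \<Omega>) (\<lambda>x. (u x)\<^sup>2)"
    by (rule integrable_cong_AE_imp) (use u ae in auto)
  with u show ?thesis by (simp add: L2_def)
qed

text \<open>The measure whose density is the gradient of the polynomial is admissible. It represents the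
  gradient of \<open>u\<close>, and its \<open>nabla_N\<close> has the constant densities \<open>0\<close>, \<open>A + C\<close>, \<open>C - A\<close>
  and \<open>2 * B\<close>; the first is the symmetry of second derivatives.\<close>

lemma quadratic_in_nullspace:
  assumes \<Omega>: "open \<Omega>" "bounded \<Omega>" and ae: "AE x in lebesgue_on \<Omega>. u x = quadratic A B C a b c x"
    and R: "\<beta> $ 2 * (A + C) = 0" "\<beta> $ 3 * (C - A) = 0" "\<beta> $ 4 * B = 0"
  shows "u \<in> nullspace \<Omega> \<beta>"
proof -
  define G :: "real^2 \<Rightarrow> real^2" where
    "G x = vector [quadratic 0 0 0 A B a x, quadratic 0 0 0 B C b x]" for x
  have G: "G x $ 1 = quadratic 0 0 0 A B a x" "G x $ 2 = quadratic 0 0 0 B C b x" for x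
    by (simp_all add: G_def)
  have cont: "continuous_on UNIV (\<lambda>x. G x $ i)" for i
    using exhaust_2[of i] continuous_on_quadratic by (auto simp: G)
  let ?W = "measure_distr \<Omega> (density_measure \<Omega> G)"
  note L2 = AE_continuous_imp_L2[OF \<Omega> continuous_on_quadratic ae]
  have W: "?W \<phi> $ 1 = fun_distr \<Omega> (quadratic 0 0 0 A B a) \<phi>"
    "?W \<phi> $ 2 = fun_distr \<Omega> (quadratic 0 0 0 B C b) \<phi>" if "test_function \<Omega> \<phi>" for \<phi>
    using measure_distr_density_measure[OF \<Omega> cont that] by (simp_all add: G)
  have uq: "fun_distr \<Omega> u \<phi> = fun_distr \<Omega> (quadratic A B C a b c) \<phi>" if "test_function \<Omega> \<phi>" for \<phi>
    unfolding fun_distr_def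
  proof (rule Bochner_Integration.integral_cong_AE)
    show "(\<lambda>x. u x * \<phi> x) \<in> borel_measurable (lebesgue_on \<Omega>)"
      using integrable_mult_test_function[OF \<Omega>(1) that L2_imp_integrable[OF \<Omega> L2]] by simp
    show "(\<lambda>x. quadratic A B C a b c x * \<phi> x) \<in> borel_measurable (lebesgue_on \<Omega>)"
      using integrable_mult_test_function[OF \<Omega>(1) that integrable_quadratic[OF \<Omega>]] by simp
    show "AE x in lebesgue_on \<Omega>. u x * \<phi> x = quadratic A B C a b c x * \<phi> x"
      using ae by eventually_elim simp
  qed
  note ibp = fun_distr_quadratic_pderiv_at[OF \<Omega>(1)]
  have const: "fun_distr \<Omega> (quadratic 0 0 0 0 0 k) \<phi> = k * fun_distr \<Omega> (quadratic 0 0 0 0 0 1) \<phi>" for k \<phi>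
    by (simp add: fun_distr_def quadratic_def[abs_def])
  have "distr_norm \<Omega> (\<lambda>\<phi>. grad (fun_distr \<Omega> u) \<phi> - ?W \<phi>) = 0"
  proof (rule distr_norm_eq_0)
    fix \<phi> assume \<phi>: "test_function \<Omega> \<phi>"
    show "grad (fun_distr \<Omega> u) \<phi> - ?W \<phi> = 0"
      using uq[OF test_function_pderiv_at[OF \<phi>]] ibp[OF \<phi>]
      by (simp add: vec_eq_iff forall_2 grad_def distr_pderiv_def W[OF \<phi>])
  qed
  moreover have "distr_norm \<Omega> (diag_mult \<beta> (nabla_N ?W)) = 0"
  proof (rule distr_norm_eq_0)
    fix \<phi> assume \<phi>: "test_function \<Omega> \<phi>"
    let ?I = "fun_distr \<Omega> (quadratic 0 0 0 0 0 1) \<phi>"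
    note W' = W[OF test_function_pderiv_at[OF \<phi>]]
    have "nabla_N ?W \<phi> $ 1 = 0" "nabla_N ?W \<phi> $ 2 = (A + C) * ?I"
      "nabla_N ?W \<phi> $ 3 = (C - A) * ?I" "nabla_N ?W \<phi> $ 4 = 2 * (B * ?I)"
      by (simp_all add: nabla_N_nth W' ibp[OF \<phi>] const[of A] const[of B] const[of C] algebra_simps)
    with R show "diag_mult \<beta> (nabla_N ?W) \<phi> = 0"
      by (auto simp: diag_mult_def vec_eq_iff forall_4)
  qed
  ultimately have "R_reg \<Omega> \<beta> u \<le> 0"
    using INF_lower[OF density_measure_radon[OF \<Omega> cont], of "\<lambda>w.
      distr_norm \<Omega> (\<lambda>\<phi>. grad (fun_distr \<Omega> u) \<phi> - measure_distr \<Omega> w \<phi>) +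
      distr_norm \<Omega> (diag_mult \<beta> (nabla_N (measure_distr \<Omega> w)))"]
    by (simp add: R_reg_def)
  with R_reg_nonneg[of \<Omega> \<beta> u] L2 show ?thesis by (simp add: nullspace_def)
qed

section \<open>The nullspaces\<close>

lemma nullspace_eq:
  assumes \<Omega>: "open \<Omega>" "connected \<Omega>" "bounded \<Omega>"
    and two: "\<beta> $ 3 \<noteq> 0 \<and> \<beta> $ 4 \<noteq> 0 \<or> \<beta> $ 2 \<noteq> 0 \<and> \<beta> $ 4 \<noteq> 0 \<or> \<beta> $ 2 \<noteq> 0 \<and> \<beta> $ 3 \<noteq> 0"
  shows "nullspace \<Omega> \<beta> = {u. \<exists>A B C a b c. (\<beta> $ 2 * (A + C) = 0 \<and> \<beta> $ 3 * (C - A) = 0 \<and> \<beta> $ 4 * B = 0) \<and>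
    (AE x in lebesgue_on \<Omega>. u x = quadratic A B C a b c x)}"
  using nullspace_imp_quadratic[OF \<Omega> _ two] quadratic_in_nullspace[OF \<Omega>(1,3)] by blast

theorem mainTheorem4:
  fixes \<Omega> :: "(real^2) set" and \<beta>1 \<beta>2 \<beta>3 \<beta>4 :: real and \<beta> :: "real^4"
  assumes "bounded_lipschitz_domain \<Omega>"
    and "\<beta>1 \<ge> 0" and "\<beta>2 \<ge> 0" and "\<beta>3 \<ge> 0" and "\<beta>4 \<ge> 0"
    and "\<beta> = vector [sqrt \<beta>1, sqrt \<beta>2, sqrt \<beta>3, sqrt \<beta>4]"
  shows "(\<beta>2 > 0 \<and> \<beta>3 > 0 \<and> \<beta>4 > 0 \<longrightarrow>
           nullspace \<Omega> \<beta> = {u. \<exists>a b c. AE x in lebesgue_on \<Omega>.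
             u x = a * x $ 1 + b * x $ 2 + c}) \<and>
         (\<beta>2 = 0 \<and> \<beta>3 > 0 \<and> \<beta>4 > 0 \<longrightarrow>
           nullspace \<Omega> \<beta> = {u. \<exists>q a b c. AE x in lebesgue_on \<Omega>.
             u x = q * ((x $ 1)\<^sup>2 + (x $ 2)\<^sup>2) + a * x $ 1 + b * x $ 2 + c}) \<and>
         (\<beta>3 = 0 \<and> \<beta>2 > 0 \<and> \<beta>4 > 0 \<longrightarrow>
           nullspace \<Omega> \<beta> = {u. \<exists>q a b c. AE x in lebesgue_on \<Omega>.
             u x = q * ((x $ 1)\<^sup>2 - (x $ 2)\<^sup>2) + a * x $ 1 + b * x $ 2 + c}) \<and>
         (\<beta>4 = 0 \<and> \<beta>2 > 0 \<and> \<beta>3 > 0 \<longrightarrow>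
           nullspace \<Omega> \<beta> = {u. \<exists>q a b c. AE x in lebesgue_on \<Omega>.
             u x = q * (x $ 1 * x $ 2) + a * x $ 1 + b * x $ 2 + c})"
proof -
  have \<Omega>: "open \<Omega>" "connected \<Omega>" "bounded \<Omega>"
    using assms(1) by (auto simp: bounded_lipschitz_domain_def)
  have b: "\<beta> $ 2 = sqrt \<beta>2" "\<beta> $ 3 = sqrt \<beta>3" "\<beta> $ 4 = sqrt \<beta>4"
    by (simp_all add: assms(6) vector_4)
  have eq: "\<beta> $ 2 * (A + C) = 0 \<longleftrightarrow> \<beta>2 = 0 \<or> C = - A"
    "\<beta> $ 3 * (C - A) = 0 \<longleftrightarrow> \<beta>3 = 0 \<or> C = A" "\<beta> $ 4 * B = 0 \<longleftrightarrow> \<beta>4 = 0 \<or> B = 0" for A B C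
    by (auto simp: b)
  note N = nullspace_eq[OF \<Omega>, of \<beta>, unfolded eq]
  have double: "(\<exists>A. S A) \<longleftrightarrow> (\<exists>q. S (2 * q))" for S :: "real \<Rightarrow> bool"
    using field_sum_of_halves by (metis mult_2)
  show ?thesis
  proof (intro conjI impI)
    assume h: "\<beta>2 > 0 \<and> \<beta>3 > 0 \<and> \<beta>4 > 0"
    have "C = - A \<and> C = A \<and> B = 0 \<longleftrightarrow> A = 0 \<and> B = 0 \<and> C = 0" for A B C :: real by auto
    then have "nullspace \<Omega> \<beta> = {u. \<exists>a b c. AE x in lebesgue_on \<Omega>. u x = quadratic 0 0 0 a b c x}"
      using N h by (simp add: b)
    then show "nullspace \<Omega> \<beta> = {u. \<exists>a b c. AE x in lebesgue_on \<Omega>.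
        u x = a * x $ 1 + b * x $ 2 + c}"
      by (simp add: quadratic_def)
  next
    assume h: "\<beta>2 = 0 \<and> \<beta>3 > 0 \<and> \<beta>4 > 0"
    then have "nullspace \<Omega> \<beta> = {u. \<exists>A a b c. AE x in lebesgue_on \<Omega>. u x = quadratic A 0 A a b c x}"
      using N by (simp add: b)
    also have "\<dots> = {u. \<exists>q a b c. AE x in lebesgue_on \<Omega>. u x = quadratic (2 * q) 0 (2 * q) a b c x}"
      by (intro Collect_cong double)
    also have "\<dots> = {u. \<exists>q a b c. AE x in lebesgue_on \<Omega>.
        u x = q * ((x $ 1)\<^sup>2 + (x $ 2)\<^sup>2) + a * x $ 1 + b * x $ 2 + c}"
      by (simp add: quadratic_def right_diff_distrib distrib_left)
    finally show "nullspace \<Omega> \<beta> = {u. \<exists>q a b c. AE x in lebesgue_on \<Omega>.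
        u x = q * ((x $ 1)\<^sup>2 + (x $ 2)\<^sup>2) + a * x $ 1 + b * x $ 2 + c}" .
  next
    assume h: "\<beta>3 = 0 \<and> \<beta>2 > 0 \<and> \<beta>4 > 0"
    then have "nullspace \<Omega> \<beta> = {u. \<exists>A a b c. AE x in lebesgue_on \<Omega>. u x = quadratic A 0 (- A) a b c x}"
      using N by (simp add: b)
    also have "\<dots> = {u. \<exists>q a b c. AE x in lebesgue_on \<Omega>. u x = quadratic (2 * q) 0 (- (2 * q)) a b c x}"
      by (intro Collect_cong double)
    also have "\<dots> = {u. \<exists>q a b c. AE x in lebesgue_on \<Omega>.
        u x = q * ((x $ 1)\<^sup>2 - (x $ 2)\<^sup>2) + a * x $ 1 + b * x $ 2 + c}"
      by (simp add: quadratic_def right_diff_distrib distrib_left)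
    finally show "nullspace \<Omega> \<beta> = {u. \<exists>q a b c. AE x in lebesgue_on \<Omega>.
        u x = q * ((x $ 1)\<^sup>2 - (x $ 2)\<^sup>2) + a * x $ 1 + b * x $ 2 + c}" .
  next
    assume h: "\<beta>4 = 0 \<and> \<beta>2 > 0 \<and> \<beta>3 > 0"
    have "C = - A \<and> C = A \<longleftrightarrow> A = 0 \<and> C = 0" for A C :: real by auto
    then have "nullspace \<Omega> \<beta> = {u. \<exists>q a b c. AE x in lebesgue_on \<Omega>. u x = quadratic 0 q 0 a b c x}"
      using N h by (simp add: b)
    then show "nullspace \<Omega> \<beta> = {u. \<exists>q a b c. AE x in lebesgue_on \<Omega>.
        u x = q * (x $ 1 * x $ 2) + a * x $ 1 + b * x $ 2 + c}"
      by (simp add: quadratic_def)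
  qed
qed

end
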